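(* Every finite-dimensional irreducible representation $V$ of the twisted super Yangian $\mathscr B_{\mathbf s,\boldsymbol\varepsilon}$ is a highest $\ell_{\mathbf s,\boldsymbol\varepsilon}$-weight representation. Moreover, $V$ contains a unique (up to proportionality) highest $\ell_{\mathbf s,\boldsymbol\varepsilon}$-weight vector.
   Context: Fix integers $m,n\ge0$, $\kappa=m+n$, a parity sequence $\mathbf s=(s_1,\dots,s_\kappa)\in\{\pm1\}^\kappa$ with exactly $m$ entries $1$, $s_i=(-1)^{|i|}$; $V_0=\mathbb C^{m|n}$ with basis $v_i$ of parity $|i|$ and matrix units $E_{ij}$; $R(u)=1-\frac1u\sum_{i,j}s_jE_{ij}\otimes E_{ji}$. Fix $\boldsymbol\varepsilon=(\varepsilon_1,\dots,\varepsilon_\kappa)\in\{\pm1\}^\kappa$. The twisted super Yangian $\mathscr B_{\mathbf s,\boldsymbol\varepsilon}$ is the unital associative superalgebra generated by $b_{ij}^{(r)}$ ($1\le i,j\le\kappa$, $r\ge1$) of parity $|i|+|j|$, with $b_{ij}(u)=\delta_{ij}\varepsilon_i+\sum_{r\ge1}b_{ij}^{(r)}u^{-r}$, $B(u)=\sum(-1)^{|i||j|+|j|}b_{ij}(u)\otimes E_{ij}$, and relations $R(u-v)B_1(u)R(u+v)B_2(v)=B_2(v)R(u+v)B_1(u)R(u-v)$ and $B(u)B(-u)=1$. A representation $V$ is highest $\ell_{\mathbf s,\boldsymbol\varepsilon}$-weight if it is generated by a nonzero vector $\eta$ (a highest $\ell_{\mathbf s,\boldsymbol\varepsilon}$-weight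 vector) with $b_{ij}(u)\eta=0$ for $1\le i<j\le\kappa$ and $b_{ii}(u)\eta=\mu_i(u)\eta$ for some $\mu_i(u)\in\varepsilon_i+u^{-1}\mathbb C[[u^{-1}]]$. *)

theory Defs
  imports "HOL-Analysis.Analysis"
begin

type_synonym 'd op = "complex^'d^'d"
type_synonym 'd ten2 = "nat \<Rightarrow> nat \<Rightarrow> 'd op"
type_synonym 'd ten3 = "nat \<Rightarrow> nat \<Rightarrow> nat \<Rightarrow> nat \<Rightarrow> 'd op"
(* two-variable series: F a b is the coefficient of u^a v^b (a, b integers) *)
type_synonym 'd ser = "int \<Rightarrow> int \<Rightarrow> 'd ten3"

definition pty :: "(nat \<Rightarrow> int) \<Rightarrow> nat \<Rightarrow> nat" where
  "pty s i = (if s i = 1 then 0 else 1)"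

definition cB :: "(nat \<Rightarrow> int) \<Rightarrow> nat \<Rightarrow> nat \<Rightarrow> real" where
  "cB s i j = (-1) ^ (pty s i * pty s j + pty s j)"

(* coefficient of u^{-r} in b_ij(u): r = 0 gives delta_ij epsilon_i *)
definition bcoef :: "(nat \<Rightarrow> int) \<Rightarrow> (nat \<Rightarrow> nat \<Rightarrow> nat \<Rightarrow> 'd::finite op) \<Rightarrow> nat \<Rightarrow> nat \<Rightarrow> nat \<Rightarrow> 'd op" where
  "bcoef \<epsilon> \<rho> r i j = (if r = 0 then (if i = j then real_of_int (\<epsilon> i) *\<^sub>R mat 1 else 0) else \<rho> i j r)"

(* product in End(V) (x) End(C^{m|n}):  (a (x) E_ij)(a' (x) E_jl) = (-1)^{|E_ij||a'|} aa' (x) E_il *)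
definition tmul2 :: "nat \<Rightarrow> (nat \<Rightarrow> int) \<Rightarrow> 'd::finite ten2 \<Rightarrow> 'd ten2 \<Rightarrow> 'd ten2" where
  "tmul2 \<kappa> s T S = (\<lambda>i l. \<Sum>j\<in>{1..\<kappa>}.
      (-1::real) ^ ((pty s i + pty s j) * (pty s j + pty s l)) *\<^sub>R (T i j ** S j l))"

(* product in End(V) (x) End (x) End:
   (a (x) X (x) Y)(a' (x) X' (x) Y') = (-1)^{|Y|(|a'|+|X'|) + |X||a'|} aa' (x) XX' (x) YY',
   with X = E_{i j0}, Y = E_{k l0}, X' = E_{j0 j}, Y' = E_{l0 l}, |a'| = |j0|+|j|+|l0|+|l| *)
definition tmul3 :: "nat \<Rightarrow> (nat \<Rightarrow> int) \<Rightarrow> 'd::finite ten3 \<Rightarrow> 'd ten3 \<Rightarrow> 'd ten3" where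
  "tmul3 \<kappa> s T S = (\<lambda>i j k l. \<Sum>j0\<in>{1..\<kappa>}. \<Sum>l0\<in>{1..\<kappa>}.
      (-1::real) ^ ((pty s k + pty s l0) * ((pty s j0 + pty s j + pty s l0 + pty s l) + (pty s j0 + pty s j))
                    + (pty s i + pty s j0) * (pty s j0 + pty s j + pty s l0 + pty s l))
      *\<^sub>R (T i j0 k l0 ** S j0 j l0 l))"

(* product of two-variable series whose exponents (in u and in v) are all <= 2;
   all series multiplied below satisfy this, so this is the exact coefficient of u^p v^q *)
definition sprod :: "nat \<Rightarrow> (nat \<Rightarrow> int) \<Rightarrow> 'd::finite ser \<Rightarrow> 'd ser \<Rightarrow> 'd::finite ser" where
  "sprod \<kappa> s F G = (\<lambda>p q i j k l. \<Sum>a\<in>{p-2..2}. \<Sum>b\<in>{q-2..2}.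
      tmul3 \<kappa> s (F a b) (G (p - a) (q - b)) i j k l)"

definition id3 :: "'d::finite ten3" where
  "id3 = (\<lambda>i j k l. if i = j \<and> k = l then mat 1 else 0)"

(* P = sum_{i,j} s_j E_ij (x) E_ji, with coefficient 1 in End(V) *)
definition Ptens :: "(nat \<Rightarrow> int) \<Rightarrow> 'd::finite ten3" where
  "Ptens s = (\<lambda>i j k l. if k = j \<and> l = i then real_of_int (s j) *\<^sub>R mat 1 else 0)"

(* (u - v) R(u - v) = (u - v) 1 - P  *)
definition Rminus :: "(nat \<Rightarrow> int) \<Rightarrow> 'd::finite ser" where
  "Rminus s = (\<lambda>a b. if a = 1 \<and> b = 0 then id3 else if a = 0 \<and> b = 1 then (\<lambda>i j k l. - id3 i j k l)
                     else if a = 0 \<and> b = 0 then (\<lambda>i j k l. - Ptens s i j k l) else (\<lambda>i j k l. 0))"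

(* (u + v) R(u + v) = (u + v) 1 - P  *)
definition Rplus :: "(nat \<Rightarrow> int) \<Rightarrow> 'd::finite ser" where
  "Rplus s = (\<lambda>a b. if a = 1 \<and> b = 0 then id3 else if a = 0 \<and> b = 1 then id3
                     else if a = 0 \<and> b = 0 then (\<lambda>i j k l. - Ptens s i j k l) else (\<lambda>i j k l. 0))"

(* B_1(u) = sum (-1)^{|i||j|+|j|} b_ij(u) (x) E_ij (x) 1 ;  B_2(v) = sum ... b_kl(v) (x) 1 (x) E_kl *)
definition SB1 :: "(nat \<Rightarrow> int) \<Rightarrow> (nat \<Rightarrow> int) \<Rightarrow> (nat \<Rightarrow> nat \<Rightarrow> nat \<Rightarrow> 'd op) \<Rightarrow> 'd::finite ser" where
  "SB1 s \<epsilon> \<rho> = (\<lambda>a b. if b = 0 \<and> a \<le> 0 then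
      (\<lambda>i j k l. if k = l then cB s i j *\<^sub>R bcoef \<epsilon> \<rho> (nat (- a)) i j else 0) else (\<lambda>i j k l. 0))"

definition SB2 :: "(nat \<Rightarrow> int) \<Rightarrow> (nat \<Rightarrow> int) \<Rightarrow> (nat \<Rightarrow> nat \<Rightarrow> nat \<Rightarrow> 'd op) \<Rightarrow> 'd::finite ser" where
  "SB2 s \<epsilon> \<rho> = (\<lambda>a b. if a = 0 \<and> b \<le> 0 then
      (\<lambda>i j k l. if i = j then cB s k l *\<^sub>R bcoef \<epsilon> \<rho> (nat (- b)) k l else 0) else (\<lambda>i j k l. 0))"

(* R(u-v) B_1(u) R(u+v) B_2(v) = B_2(v) R(u+v) B_1(u) R(u-v), multiplied by (u-v)(u+v) *)
definition reflection_rel :: "nat \<Rightarrow> (nat \<Rightarrow> int) \<Rightarrow> (nat \<Rightarrow> int) \<Rightarrow> (nat \<Rightarrow> nat \<Rightarrow> nat \<Rightarrow> 'd::finite op) \<Rightarrow> bool" where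
  "reflection_rel \<kappa> s \<epsilon> \<rho> \<longleftrightarrow>
     (\<forall>p q. \<forall>i\<in>{1..\<kappa>}. \<forall>j\<in>{1..\<kappa>}. \<forall>k\<in>{1..\<kappa>}. \<forall>l\<in>{1..\<kappa>}.
        sprod \<kappa> s (sprod \<kappa> s (sprod \<kappa> s (Rminus s) (SB1 s \<epsilon> \<rho>)) (Rplus s)) (SB2 s \<epsilon> \<rho>) p q i j k l
      = sprod \<kappa> s (sprod \<kappa> s (sprod \<kappa> s (SB2 s \<epsilon> \<rho>) (Rplus s)) (SB1 s \<epsilon> \<rho>)) (Rminus s) p q i j k l)"

(* coefficient of u^{-r} in B(u) *)
definition Bten :: "(nat \<Rightarrow> int) \<Rightarrow> (nat \<Rightarrow> int) \<Rightarrow> (nat \<Rightarrow> nat \<Rightarrow> nat \<Rightarrow> 'd::finite op) \<Rightarrow> nat \<Rightarrow> 'd ten2" where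
  "Bten s \<epsilon> \<rho> r = (\<lambda>i j. cB s i j *\<^sub>R bcoef \<epsilon> \<rho> r i j)"

(* B(u) B(-u) = 1, coefficient of u^{-N} *)
definition unitary_rel :: "nat \<Rightarrow> (nat \<Rightarrow> int) \<Rightarrow> (nat \<Rightarrow> int) \<Rightarrow> (nat \<Rightarrow> nat \<Rightarrow> nat \<Rightarrow> 'd::finite op) \<Rightarrow> bool" where
  "unitary_rel \<kappa> s \<epsilon> \<rho> \<longleftrightarrow>
     (\<forall>N. \<forall>i\<in>{1..\<kappa>}. \<forall>l\<in>{1..\<kappa>}.
        (\<Sum>r\<in>{0..N}. tmul2 \<kappa> s (Bten s \<epsilon> \<rho> r)
              (\<lambda>a b. (-1::real) ^ (N - r) *\<^sub>R Bten s \<epsilon> \<rho> (N - r) a b) i l)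
      = (if N = 0 \<and> i = l then mat 1 else 0))"

(* rho is a representation of the twisted super Yangian on the super space (complex^'d, pv):
   generators act by homogeneous operators of parity |i|+|j| and the defining relations hold *)
definition is_rep :: "nat \<Rightarrow> (nat \<Rightarrow> int) \<Rightarrow> (nat \<Rightarrow> int) \<Rightarrow> ('d::finite \<Rightarrow> bool)
      \<Rightarrow> (nat \<Rightarrow> nat \<Rightarrow> nat \<Rightarrow> 'd::finite op) \<Rightarrow> bool" where
  "is_rep \<kappa> s \<epsilon> pv \<rho> \<longleftrightarrow>
     (\<forall>i\<in>{1..\<kappa>}. \<forall>j\<in>{1..\<kappa>}. \<forall>r\<ge>1. \<forall>a b. \<rho> i j r $ a $ b \<noteq> 0 \<longrightarrow>
          ((pv a \<noteq> pv b) \<longleftrightarrow> odd (pty s i + pty s j)))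
   \<and> reflection_rel \<kappa> s \<epsilon> \<rho> \<and> unitary_rel \<kappa> s \<epsilon> \<rho>"

definition csubspace :: "(complex^'d::finite) set \<Rightarrow> bool" where
  "csubspace W \<longleftrightarrow> 0 \<in> W \<and> (\<forall>x\<in>W. \<forall>y\<in>W. x + y \<in> W) \<and> (\<forall>c x. x \<in> W \<longrightarrow> c *s x \<in> W)"

definition invariant :: "nat \<Rightarrow> (nat \<Rightarrow> nat \<Rightarrow> nat \<Rightarrow> 'd::finite op) \<Rightarrow> (complex^'d) set \<Rightarrow> bool" where
  "invariant \<kappa> \<rho> W \<longleftrightarrow> (\<forall>i\<in>{1..\<kappa>}. \<forall>j\<in>{1..\<kappa>}. \<forall>r\<ge>1. \<forall>x\<in>W. \<rho> i j r *v x \<in> W)"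

(* a Z/2-graded subspace: contains the even (hence also the odd) component of each element *)
definition graded :: "('d::finite \<Rightarrow> bool) \<Rightarrow> (complex^'d) set \<Rightarrow> bool" where
  "graded pv W \<longleftrightarrow> (\<forall>x\<in>W. (\<chi> a. if pv a then 0 else x $ a) \<in> W)"

(* irreducible: V is nonzero (automatic for complex^'d) and has no graded submodules except 0 and V *)
definition irreducible_rep :: "nat \<Rightarrow> ('d::finite \<Rightarrow> bool) \<Rightarrow> (nat \<Rightarrow> nat \<Rightarrow> nat \<Rightarrow> 'd::finite op) \<Rightarrow> bool" where
  "irreducible_rep \<kappa> pv \<rho> \<longleftrightarrow>
     (\<forall>W. csubspace W \<and> invariant \<kappa> \<rho> W \<and> graded pv W \<longrightarrow> W = {0} \<or> W = UNIV)"

definition generated :: "nat \<Rightarrow> (nat \<Rightarrow> nat \<Rightarrow> nat \<Rightarrow> 'd::finite op) \<Rightarrow> complex^'d \<Rightarrow> (complex^'d) set" where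
  "generated \<kappa> \<rho> \<eta> = \<Inter>{W. csubspace W \<and> invariant \<kappa> \<rho> W \<and> \<eta> \<in> W}"

(* highest l-weight vector: nonzero, generates V, b_ij(u) eta = 0 for i<j,
   b_ii(u) eta = mu_i(u) eta with mu_i(u) in eps_i + u^{-1} C[[u^{-1}]] *)
definition hw_vector :: "nat \<Rightarrow> (nat \<Rightarrow> nat \<Rightarrow> nat \<Rightarrow> 'd::finite op) \<Rightarrow> complex^'d \<Rightarrow> bool" where
  "hw_vector \<kappa> \<rho> \<eta> \<longleftrightarrow> \<eta> \<noteq> 0 \<and> generated \<kappa> \<rho> \<eta> = UNIV
     \<and> (\<forall>i j. 1 \<le> i \<and> i < j \<and> j \<le> \<kappa> \<longrightarrow> (\<forall>r\<ge>1. \<rho> i j r *v \<eta> = 0))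
     \<and> (\<forall>i\<in>{1..\<kappa>}. \<forall>r\<ge>1. \<exists>c. \<rho> i i r *v \<eta> = c *s \<eta>)"

end

theory Submission
  imports Defs "HOL-Computational_Algebra.Fundamental_Theorem_Algebra"
begin

text \<open>
  The coefficient of \<open>u\<close> in the reflection equation shows that
  \<open>h = (\<Sum>i. (\<kappa> - i) s\<^sub>i \<epsilon>\<^sub>i b\<^sub>i\<^sub>i\<^sup>(\<^sup>1\<^sup>))\<close> satisfies \<open>[h, b\<^sub>k\<^sub>l(u)] = 2 (l - k) b\<^sub>k\<^sub>l(u)\<close>. An eigenspace of \<open>h\<close>
  whose eigenvalue has nearly maximal real part is therefore killed by all \<open>b\<^sub>k\<^sub>l(u)\<close> with \<open>k < l\<close> and
  preserved by the \<open>b\<^sub>i\<^sub>i(u)\<close>. On vectors killed in this way the \<open>b\<^sub>i\<^sub>i(u)\<close> commute, so they have a common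
  homogeneous eigenvector, which generates the module by irreducibility.

  For uniqueness, filter by giving \<open>b\<^sup>(\<^sup>r\<^sup>)\<close> degree \<open>r\<close>. Generators supercommute up to lower degree, so by
  induction on the degree a highest weight vector \<open>\<eta>\<close> of \<open>h\<close>-eigenvalue \<open>c\<close> generates only combinations of
  \<open>\<eta>\<close> and of \<open>h\<close>-eigenvectors with eigenvalues \<open>c - n\<close>, \<open>n \<ge> 1\<close>. Two highest weight vectors thus have the
  same eigenvalue and are proportional.
\<close>

section \<open>Linear algebra\<close>

lemma scaleR_matrix_mult:
  fixes A :: "complex^'n^'m" and B :: "complex^'k^'n"
  shows "(r *\<^sub>R A) ** B = r *\<^sub>R (A ** B)" "A ** (r *\<^sub>R B) = r *\<^sub>R (A ** B)"
  by (simp_all add: vec_eq_iff matrix_matrix_mult_def scaleR_sum_right)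

lemma matrix_mult_uminus:
  fixes A :: "complex^'n^'m" and B :: "complex^'k^'n"
  shows "(- A) ** B = - (A ** B)" "A ** (- B) = - (A ** B)"
  by (simp_all add: vec_eq_iff matrix_matrix_mult_def sum_negf)

lemma matrix_mult_zero [simp]:
  fixes A :: "complex^'n^'m" and B :: "complex^'k^'n"
  shows "0 ** B = 0" "A ** (0::complex^'k^'n) = 0"
  by (simp_all add: vec_eq_iff matrix_matrix_mult_def)

lemma matrix_mult_add:
  fixes A :: "complex^'n^'m" and B :: "complex^'k^'n"
  shows "(A + A') ** B = A ** B + A' ** B" "A ** (B + B') = A ** B + A ** B'"
   "(A - A') ** B = A ** B - A' ** B" "A ** (B - B') = A ** B - A ** B'"
  by (simp_all add: vec_eq_iff matrix_matrix_mult_def sum.distrib sum_subtractf algebra_simps)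

lemma matrix_mult_two: "(2 * A) ** B = 2 * (A ** B)" for A :: "complex^'n^'m" and B :: "complex^'k^'n"
  by (simp only: mult_2 matrix_mult_add)

lemma scaleR_mv: "(c *\<^sub>R A) *v x = c *\<^sub>R (A *v x)" for A :: "complex^'n^'m"
  by (simp add: vec_eq_iff matrix_vector_mult_def scaleR_sum_right)

lemma sum_mv: "(\<Sum>i\<in>I. f i) *v x = (\<Sum>i\<in>I. f i *v x)" for f :: "_ \<Rightarrow> complex^'n^'m"
  by (induction I rule: infinite_finite_induct) (simp_all add: matrix_vector_mult_add_rdistrib)

lemma mult_mv: "(A ** B) *v x = A *v (B *v x)" for A :: "complex^'n^'m"
  by (simp add: matrix_vector_mul_assoc)

lemmas mv_simps = matrix_vector_mult_add_rdistrib matrix_vector_mult_diff_rdistrib scaleR_mv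

lemma mv_smult: "A *v (c *s x) = c *s (A *v x)" for A :: "complex^'n^'m"
  by (simp add: vec_eq_iff matrix_vector_mult_def vector_scalar_mult_def sum_distrib_left mult_ac)

lemma csubspace_iff: "csubspace W \<longleftrightarrow> vec.subspace W"
  by (auto simp: csubspace_def vec.subspace_def)

lemma scaleR_smult: "r *\<^sub>R x = complex_of_real r *s x" for x :: "complex^'n"
  unfolding vec_eq_iff vector_scaleR_component vector_smult_component by (simp add: scaleR_conv_of_real)

section \<open>Vectors \<open>p(M) x\<close> for a complex polynomial \<open>p\<close> and a matrix
  \<open>M\<close>, and the existence of eigenvectors\<close>

definition poly_apply :: "complex^'n^'n \<Rightarrow> complex poly \<Rightarrow> complex^'n \<Rightarrow> complex^'n" where
  "poly_apply M p x = fold_coeffs (\<lambda>a y. a *s x + M *v y) p 0"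

lemma poly_apply_0 [simp]: "poly_apply M 0 x = 0"
  by (simp add: poly_apply_def)

lemma poly_apply_pCons: "poly_apply M (pCons a p) x = a *s x + M *v poly_apply M p x"
  by (cases "p = 0 \<and> a = 0") (auto simp: poly_apply_def)

lemma poly_apply_add: "poly_apply M (p + q) x = poly_apply M p x + poly_apply M q x"
  by (induction p q rule: poly_induct2)
     (simp_all add: poly_apply_pCons vector_sadd_rdistrib matrix_vector_right_distrib algebra_simps)

lemma poly_apply_smult: "poly_apply M (smult c p) x = c *s poly_apply M p x"
  by (induction p) (simp_all add: poly_apply_pCons vector_add_ldistrib mv_smult vector_smult_assoc)

lemma poly_apply_sum: "poly_apply M (\<Sum>i\<in>I. p i) x = (\<Sum>i\<in>I. poly_apply M (p i) x)"
  by (induction I rule: infinite_finite_induct) (simp_all add: poly_apply_add)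

lemma poly_apply_monom: "poly_apply M (monom c n) x = c *s (((*v) M ^^ n) x)"
  by (induction n) (simp_all add: monom_0 monom_Suc poly_apply_pCons mv_smult)

lemma poly_apply_in:
  assumes "csubspace W" "\<And>x. x \<in> W \<Longrightarrow> M *v x \<in> W" "x \<in> W"
  shows "poly_apply M p x \<in> W"
  using assms by (induction p) (auto simp: poly_apply_pCons csubspace_def)

lemma poly_apply_right_add: "poly_apply M p (x + y) = poly_apply M p x + poly_apply M p y"
  by (induction p) (simp_all add: poly_apply_pCons vector_add_ldistrib matrix_vector_right_distrib)

lemma poly_apply_right_smult: "poly_apply M p (c *s x) = c *s poly_apply M p x"
  by (induction p) (simp_all add: poly_apply_pCons vector_add_ldistrib mv_smult vector_smult_assoc mult.commute)

lemma poly_apply_eigen: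
  assumes "M *v x = c *s x"
  shows "poly_apply M p x = poly p c *s x"
  by (induction p) (simp_all add: poly_apply_pCons mv_smult assms vector_sadd_rdistrib vector_smult_assoc mult.commute)

text \<open>In dimension \<open>n\<close> the iterates \<open>x, M x, ..., M^n x\<close> either
  repeat, and a difference of two monomials annihilates \<open>x\<close>, or are
  \<open>n + 1\<close> distinct and hence dependent vectors, and a dependence relation supplies the
  coefficients of \<open>p\<close>.\<close>

lemma annihilating_poly: "\<exists>p. p \<noteq> 0 \<and> poly_apply M p x = 0" for x :: "complex^'n"
proof -
  define f where "f i = ((*v) M ^^ i) x" for i
  define n where "n = CARD('n)"
  show ?thesis
  proof (cases "inj_on f {..n}")
    case False
    then obtain i j where ij: "f i = f j" "i \<noteq> j" by (auto simp: inj_on_def)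
    define p where "p = monom 1 j + smult (-1) (monom (1::complex) i)"
    have "poly_apply M p x = 0"
      using ij unfolding p_def poly_apply_add poly_apply_smult poly_apply_monom f_def by simp
    moreover have "coeff p j = 1" using ij by (simp add: p_def)
    then have "p \<noteq> 0" by auto
    ultimately show ?thesis by blast
  next
    case True
    have "vec.dim (UNIV :: (complex^'n) set) < card (f ` {..n})"
      using True by (simp add: card_image n_def card_cart_basis)
    then have "vec.dependent (f ` {..n})"
      using vec.independent_card_le_dim[of "f ` {..n}" UNIV] by auto
    then obtain u where u: "\<exists>v\<in>f ` {..n}. u v \<noteq> 0" "(\<Sum>v\<in>f ` {..n}. u v *s v) = 0"
      using vec.dependent_finite[of "f ` {..n}"] by auto
    define p where "p = (\<Sum>i\<le>n. monom (u (f i)) i)"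
    have "poly_apply M p x = (\<Sum>i\<le>n. u (f i) *s f i)"
      by (simp add: p_def poly_apply_sum poly_apply_monom f_def)
    also have "\<dots> = 0" using u(2) True by (simp add: sum.reindex)
    finally have "poly_apply M p x = 0" .
    moreover obtain i where i: "i \<le> n" "u (f i) \<noteq> 0" using u(1) by auto
    then have "coeff p i = u (f i)" by (simp add: p_def coeff_sum)
    then have "p \<noteq> 0" using i by auto
    ultimately show ?thesis by blast
  qed
qed

text \<open>Let \<open>p\<close> be an annihilating polynomial of \<open>x\<close> of least degree
  and \<open>c\<close> a root, \<open>p = (X - c) q\<close>. By minimality \<open>q(M) x\<close> is
  nonzero, and \<open>M - c\<close> kills it; invariance of \<open>W\<close> keeps it in
  \<open>W\<close>.\<close>

lemma eigenvector_exists: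
  fixes M :: "complex^'n^'n"
  assumes W: "csubspace W" "\<And>x. x \<in> W \<Longrightarrow> M *v x \<in> W" and ne: "W \<noteq> {0}"
  obtains x c where "x \<in> W" "x \<noteq> 0" "M *v x = c *s x"
proof -
  obtain x where x: "x \<in> W" "x \<noteq> 0" using W(1) ne by (auto simp: csubspace_def)
  obtain p where p: "p \<noteq> 0" "poly_apply M p x = 0" and min: "\<And>q. q \<noteq> 0 \<Longrightarrow> poly_apply M q x = 0 \<Longrightarrow> degree p \<le> degree q"
    using exists_least_iff[of "\<lambda>d. \<exists>p. p \<noteq> 0 \<and> poly_apply M p x = 0 \<and> degree p = d"] annihilating_poly[of M x]
    by (metis linorder_not_less)
  have "degree p \<noteq> 0"
  proof
    assume "degree p = 0"
    then obtain a where "p = [:a:]" by (rule degree_eq_zeroE)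
    then show False using p x by (auto simp: poly_apply_pCons vec_eq_iff)
  qed
  then have "\<not> constant (poly p)" by (simp add: constant_degree)
  then obtain c where "poly p c = 0" using fundamental_theorem_of_algebra by blast
  then obtain q where q: "p = [:-c, 1:] * q" by (auto simp: poly_eq_0_iff_dvd)
  have q0: "q \<noteq> 0" using p q by auto
  have "degree p = Suc (degree q)" using q0 unfolding q by (subst degree_mult_eq) auto
  then have ne: "poly_apply M q x \<noteq> 0" using min[of q] q0 by auto
  have "p = pCons 0 q + smult (-c) q" by (simp add: q)
  then have "M *v poly_apply M q x + (-c) *s poly_apply M q x = 0"
    using p(2) poly_apply_add[of M "pCons 0 q" "smult (-c) q" x] by (simp only: poly_apply_smult poly_apply_pCons) simp
  then have "M *v poly_apply M q x = c *s poly_apply M q x" by (simp add: vec_eq_iff)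
  then show ?thesis using ne poly_apply_in[OF W x(1)] that by blast
qed

text \<open>Induction on \<open>vec.dim W\<close>: if some \<open>M\<close> in \<open>F\<close> has
  a non-eigenvector in \<open>W\<close>, an eigenspace of \<open>M\<close> in \<open>W\<close> is a
  proper nonzero subspace, and commutation makes it invariant. Commutation is assumed on
  \<open>W\<close> only, because the diagonal series will be shown to commute just on singular
  vectors.\<close>

lemma common_eigenvector:
  fixes F :: "(complex^'n^'n) set"
  assumes "csubspace W" "\<And>M x. M \<in> F \<Longrightarrow> x \<in> W \<Longrightarrow> M *v x \<in> W" "W \<noteq> {0}"
    and "\<And>M N x. M \<in> F \<Longrightarrow> N \<in> F \<Longrightarrow> x \<in> W \<Longrightarrow> M *v (N *v x) = N *v (M *v x)"
  shows "\<exists>x\<in>W. x \<noteq> 0 \<and> (\<forall>M\<in>F. \<exists>c. M *v x = c *s x)"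
  using assms
proof (induction "vec.dim W" arbitrary: W rule: less_induct)
  case less
  show ?case
  proof (cases "\<forall>M\<in>F. \<forall>x\<in>W. \<exists>c. M *v x = c *s x")
    case True
    then show ?thesis using less(2,4) unfolding csubspace_def by blast
  next
    case False
    then obtain M y where M: "M \<in> F" and y: "y \<in> W" "\<nexists>c. M *v y = c *s y" by blast
    obtain x c where x: "x \<in> W" "x \<noteq> 0" "M *v x = c *s x"
      using eigenvector_exists[of W M] less(2,3,4) M by metis
    define W' where "W' = {x \<in> W. M *v x = c *s x}"
    have W': "csubspace W'"
      using less(2) by (auto simp: csubspace_def W'_def matrix_vector_right_distrib vector_add_ldistrib mv_smult vector_smult_assoc mult.commute)
    have sub: "W' \<subseteq> W" by (auto simp: W'_def)
    have "vec.dim W' < vec.dim W"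
    proof (rule ccontr)
      assume "\<not> vec.dim W' < vec.dim W"
      then have "W' = W" using vec.subspace_dim_equal[of W' W] W' less(2) sub by (simp add: csubspace_iff)
      then show False using y by (auto simp: W'_def)
    qed
    moreover have "N *v x \<in> W'" if "N \<in> F" "x \<in> W'" for N x
      using that less(3)[of N x] less(5)[OF M that(1), of x] by (auto simp: W'_def mv_smult)
    moreover have "W' \<noteq> {0}" using x by (auto simp: W'_def)
    ultimately show ?thesis using less(1)[of W'] W' less(5) sub by blast
  qed
qed

text \<open>Compare both sides of \<open>M x = c x\<close> at a coordinate \<open>a\<close> of
  maximal modulus: \<open>norm c\<close> is at most the absolute row sum of row \<open>a\<close>.
  Summing over all rows makes the bound independent of \<open>x\<close>.\<close>

lemma eigenvalue_bound:
  fixes M :: "complex^'n^'n"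
  obtains C :: real where "\<And>x c. x \<noteq> 0 \<Longrightarrow> M *v x = c *s x \<Longrightarrow> norm c \<le> C"
proof (rule that[of "\<Sum>a\<in>UNIV. \<Sum>b\<in>UNIV. norm (M $ a $ b)"])
  fix x :: "complex^'n" and c assume x: "x \<noteq> 0" "M *v x = c *s x"
  have "finite (range (\<lambda>a. norm (x $ a)))" by simp
  then have "Max (range (\<lambda>a. norm (x $ a))) \<in> range (\<lambda>a. norm (x $ a))" by (intro Max_in) auto
  then obtain a where a: "norm (x $ a) = Max (range (\<lambda>a. norm (x $ a)))" by (metis (mono_tags, lifting) imageE)
  have max: "norm (x $ b) \<le> norm (x $ a)" for b unfolding a by simp
  have "x $ a \<noteq> 0" using x(1) max by (auto simp: vec_eq_iff)
  moreover have "norm c * norm (x $ a) = norm (\<Sum>b\<in>UNIV. M $ a $ b * x $ b)"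
    using x(2) by (simp add: vec_eq_iff matrix_vector_mult_def norm_mult[symmetric])
  moreover have "\<dots> \<le> (\<Sum>b\<in>UNIV. norm (M $ a $ b) * norm (x $ a))"
    by (intro sum_norm_le) (auto simp: norm_mult intro!: mult_left_mono max)
  ultimately have "norm c * norm (x $ a) \<le> (\<Sum>b\<in>UNIV. norm (M $ a $ b)) * norm (x $ a)" "norm (x $ a) > 0"
    by (simp_all add: sum_distrib_right)
  then have "norm c \<le> (\<Sum>b\<in>UNIV. norm (M $ a $ b))" by (rule mult_right_le_imp_le)
  also have "\<dots> \<le> (\<Sum>a\<in>UNIV. \<Sum>b\<in>UNIV. norm (M $ a $ b))"
    by (rule member_le_sum[of a UNIV "\<lambda>a. \<Sum>b\<in>UNIV. norm (M $ a $ b)"]) (auto intro: sum_nonneg)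
  finally show "norm c \<le> (\<Sum>a\<in>UNIV. \<Sum>b\<in>UNIV. norm (M $ a $ b))" .
qed

section \<open>Parity\<close>

definition parity_part :: "('d \<Rightarrow> bool) \<Rightarrow> bool \<Rightarrow> complex^'d \<Rightarrow> complex^'d" where
  "parity_part pv t x = (\<chi> a. if pv a = t then x $ a else 0)"

lemma parity_part_linear:
  "parity_part pv t (x + y) = parity_part pv t x + parity_part pv t y"
  "parity_part pv t (c *s x) = c *s parity_part pv t x"
  "parity_part pv t 0 = 0"
  by (simp_all add: parity_part_def vec_eq_iff)

lemma parity_part_sum: "parity_part pv True x + parity_part pv False x = x"
  by (auto simp: parity_part_def vec_eq_iff)

lemma parity_part_idem: "parity_part pv t (parity_part pv t' x) = (if t = t' then parity_part pv t x else 0)"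
  by (auto simp: parity_part_def vec_eq_iff)

definition homog_op :: "('d::finite \<Rightarrow> bool) \<Rightarrow> bool \<Rightarrow> complex^'d^'d \<Rightarrow> bool" where
  "homog_op pv e M \<longleftrightarrow> (\<forall>a b. M $ a $ b \<noteq> 0 \<longrightarrow> (pv a \<noteq> pv b) = e)"

text \<open>\<open>e = True\<close> means that \<open>M\<close> is odd. Parities add as exclusive
  or, which for booleans is \<open>\<noteq>\<close>.\<close>

lemma homog_op_parity_part:
  assumes "homog_op pv e M"
  shows "M *v parity_part pv t x = parity_part pv (t \<noteq> e) (M *v x)"
proof -
  have "(\<Sum>b\<in>UNIV. M $ a $ b * (if pv b = t then x $ b else 0)) = (if pv a = (t \<noteq> e) then \<Sum>b\<in>UNIV. M $ a $ b * x $ b else 0)" for a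
  proof -
    have "M $ a $ b * (if pv b = t then x $ b else 0) = (if pv a = (t \<noteq> e) then M $ a $ b * x $ b else 0)" for b
      using assms by (cases "M $ a $ b = 0") (auto simp: homog_op_def)
    moreover have "(\<Sum>b\<in>UNIV. if P then f b else 0) = (if P then sum f UNIV else 0)" for P and f :: "'d \<Rightarrow> complex"
      by (cases P) simp_all
    ultimately show ?thesis by (simp only:)
  qed
  then show ?thesis
    unfolding parity_part_def matrix_vector_mult_def vec_eq_iff vec_lambda_beta by (rule allI)
qed

lemma homog_op_sum:
  assumes "\<And>i. i \<in> I \<Longrightarrow> homog_op pv e (f i)"
  shows "homog_op pv e (\<Sum>i\<in>I. f i)"
  unfolding homog_op_def
proof (intro allI impI)
  fix a b assume "(\<Sum>i\<in>I. f i) $ a $ b \<noteq> 0"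
  then have "(\<Sum>i\<in>I. f i $ a $ b) \<noteq> 0" by simp
  then obtain i where "i \<in> I" "f i $ a $ b \<noteq> 0" by (rule sum.not_neutral_contains_not_neutral)
  then show "(pv a \<noteq> pv b) = e" using assms unfolding homog_op_def by blast
qed

section \<open>Submodules generated by a homogeneous vector\<close>

lemma generated_props:
  "csubspace (generated \<kappa> \<rho> \<eta>)" "invariant \<kappa> \<rho> (generated \<kappa> \<rho> \<eta>)" "\<eta> \<in> generated \<kappa> \<rho> \<eta>"
  "csubspace W \<Longrightarrow> invariant \<kappa> \<rho> W \<Longrightarrow> \<eta> \<in> W \<Longrightarrow> generated \<kappa> \<rho> \<eta> \<subseteq> W"
  unfolding generated_def csubspace_def invariant_def by auto

text \<open>The vectors whose two homogeneous components lie in the generated submodule form a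
  submodule themselves, and it contains the homogeneous \<open>\<eta>\<close>. This is needed
  because irreducibility speaks of graded submodules only.\<close>

lemma graded_generated:
  assumes odd: "\<And>i j r. i \<in> {1..\<kappa>} \<Longrightarrow> j \<in> {1..\<kappa>} \<Longrightarrow> r \<ge> 1 \<Longrightarrow> \<exists>e. homog_op pv e (\<rho> i j r)"
    and \<eta>: "parity_part pv t \<eta> = \<eta>"
  shows "graded pv (generated \<kappa> \<rho> \<eta>)"
proof -
  define G where "G = generated \<kappa> \<rho> \<eta>"
  note G = generated_props[where \<kappa> = \<kappa> and \<rho> = \<rho> and \<eta> = \<eta>, folded G_def]
  define G' where "G' = {x. \<forall>t. parity_part pv t x \<in> G}"
  have "parity_part pv t' \<eta> \<in> G" for t'
    using parity_part_idem[of pv t' t \<eta>] \<eta> G(1,3) by (cases "t' = t") (auto simp: csubspace_def)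
  then have "\<eta> \<in> G'" by (simp add: G'_def)
  moreover have "csubspace G'"
    using G(1) by (auto simp: csubspace_def G'_def parity_part_linear)
  moreover have "invariant \<kappa> \<rho> G'"
    unfolding invariant_def
  proof (intro ballI allI impI)
    fix i j r x assume ij: "i \<in> {1..\<kappa>}" "j \<in> {1..\<kappa>}" "(1::nat) \<le> r" "x \<in> G'"
    then obtain e where e: "homog_op pv e (\<rho> i j r)" using odd by blast
    have "parity_part pv t (\<rho> i j r *v x) \<in> G" for t
    proof -
      have "\<rho> i j r *v parity_part pv (t \<noteq> e) x \<in> G"
        using G(2) ij unfolding invariant_def G'_def by blast
      moreover have "((t \<noteq> e) \<noteq> e) = t" by blast
      ultimately show ?thesis unfolding homog_op_parity_part[OF e] by simp
    qed
    then show "\<rho> i j r *v x \<in> G'" by (simp add: G'_def)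
  qed
  ultimately have "G \<subseteq> G'" using G(4) by blast
  moreover have "(\<chi> a. if pv a then 0 else x $ a) = parity_part pv False x" for x
    by (auto simp: parity_part_def vec_eq_iff)
  ultimately show ?thesis unfolding graded_def G_def[symmetric] G'_def by auto
qed

section \<open>Component form of the reflection equation\<close>

lemma sum_sum_delta:
  assumes "finite A" "finite B"
  shows "(\<Sum>a\<in>A. \<Sum>b\<in>B. if a = a0 \<and> b = b0 then f a b else 0)
       = (if a0 \<in> A \<and> b0 \<in> B then f a0 b0 else (0::'a::comm_monoid_add))"
proof -
  have "(\<Sum>b\<in>B. if a = a0 \<and> b = b0 then f a b else 0)
      = (if a = a0 then (if b0 \<in> B then f a0 b0 else 0) else 0)" for a
    using assms(2) by (cases "a = a0") (simp_all add: sum.delta)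
  then show ?thesis using assms(1) by (simp add: sum.delta)
qed

lemma tmul3_id3_left:
  assumes "i \<in> {1..\<kappa>}" "k \<in> {1..\<kappa>}"
  shows "tmul3 \<kappa> s id3 G i j k l = G i j k l"
proof -
  have "tmul3 \<kappa> s id3 G i j k l = (\<Sum>j0\<in>{1..\<kappa>}. \<Sum>l0\<in>{1..\<kappa>}. if j0 = i \<and> l0 = k then G i j k l else 0)"
    unfolding tmul3_def id3_def by (intro sum.cong refl) auto
  then show ?thesis using assms by (simp add: sum_sum_delta)
qed

lemma tmul3_id3_right:
  assumes "j \<in> {1..\<kappa>}" "l \<in> {1..\<kappa>}"
  shows "tmul3 \<kappa> s G id3 i j k l = G i j k l"
proof -
  have "tmul3 \<kappa> s G id3 i j k l = (\<Sum>j0\<in>{1..\<kappa>}. \<Sum>l0\<in>{1..\<kappa>}. if j0 = j \<and> l0 = l then G i j k l else 0)"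
    unfolding tmul3_def id3_def by (intro sum.cong refl) auto
  then show ?thesis using assms by (simp add: sum_sum_delta)
qed

text \<open>Only the term \<open>j0 = k\<close>, \<open>l0 = i\<close> meets the support of
  \<open>P\<close>. In its Koszul sign the parity of the coefficient of \<open>G\<close> enters
  twice and cancels, leaving the sign of the exchanged row indices.\<close>

lemma tmul3_P_left:
  assumes "i \<in> {1..\<kappa>}" "k \<in> {1..\<kappa>}"
  shows "tmul3 \<kappa> s (Ptens s) G i j k l
     = ((-1) ^ ((pty s i + pty s k) * (pty s k + pty s j)) * real_of_int (s k)) *\<^sub>R G k j i l"
proof -
  have "tmul3 \<kappa> s (Ptens s) G i j k l = (\<Sum>j0\<in>{1..\<kappa>}. \<Sum>l0\<in>{1..\<kappa>}. if j0 = k \<and> l0 = i then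
     ((-1) ^ ((pty s i + pty s k) * (pty s k + pty s j)) * real_of_int (s k)) *\<^sub>R G k j i l else 0)"
    unfolding tmul3_def Ptens_def
    by (intro sum.cong refl) (auto simp: scaleR_matrix_mult pty_def)
  then show ?thesis using assms by (simp add: sum_sum_delta)
qed

lemma tmul3_P_right:
  assumes "j \<in> {1..\<kappa>}" "l \<in> {1..\<kappa>}"
  shows "tmul3 \<kappa> s G (Ptens s) i j k l
     = ((-1) ^ ((pty s k + pty s j) * (pty s j + pty s l)) * real_of_int (s j)) *\<^sub>R G i l k j"
proof -
  have "tmul3 \<kappa> s G (Ptens s) i j k l = (\<Sum>j0\<in>{1..\<kappa>}. \<Sum>l0\<in>{1..\<kappa>}. if j0 = l \<and> l0 = j then
     ((-1) ^ ((pty s k + pty s j) * (pty s j + pty s l)) * real_of_int (s j)) *\<^sub>R G i l k j else 0)"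
    unfolding tmul3_def Ptens_def
    by (intro sum.cong refl) (auto simp: scaleR_matrix_mult pty_def)
  then show ?thesis using assms by (simp add: sum_sum_delta)
qed

lemma tmul3_uminus:
  "tmul3 \<kappa> s (\<lambda>i j k l. - F i j k l) G i j k l = - tmul3 \<kappa> s F G i j k l"
  "tmul3 \<kappa> s F (\<lambda>i j k l. - G i j k l) i j k l = - tmul3 \<kappa> s F G i j k l"
  unfolding tmul3_def by (simp_all add: matrix_mult_uminus sum_negf)

lemma tmul3_zero [simp]:
  "tmul3 \<kappa> s (\<lambda>i j k l. 0) G i j k l = 0"
  "tmul3 \<kappa> s F (\<lambda>i j k l. 0) i j k l = 0"
  unfolding tmul3_def by simp_all

text \<open>The coefficients of \<open>(u + t v) - P\<close>. The parameter \<open>t\<close> lets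
  the two R-matrix factors, \<open>t = -1\<close> and \<open>t = 1\<close>, share all
  computations.\<close>

definition Rspec :: "real \<Rightarrow> (nat \<Rightarrow> int) \<Rightarrow> 'd::finite ser" where
  "Rspec t s = (\<lambda>a b. if a = 1 \<and> b = 0 then id3 else if a = 0 \<and> b = 1 then (\<lambda>i j k l. t *\<^sub>R id3 i j k l)
                     else if a = 0 \<and> b = 0 then (\<lambda>i j k l. - Ptens s i j k l) else (\<lambda>i j k l. 0))"

lemma Rminus_Rplus_eq: "Rminus s = Rspec (-1) s" "Rplus s = Rspec 1 s"
  by (auto simp: Rminus_def Rplus_def Rspec_def fun_eq_iff)

lemma tmul3_scaleR:
  "tmul3 \<kappa> s (\<lambda>i j k l. t *\<^sub>R F i j k l) G i j k l = t *\<^sub>R tmul3 \<kappa> s F G i j k l"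
  "tmul3 \<kappa> s F (\<lambda>i j k l. t *\<^sub>R G i j k l) i j k l = t *\<^sub>R tmul3 \<kappa> s F G i j k l"
  unfolding tmul3_def by (simp_all add: scaleR_matrix_mult scaleR_sum_right mult.commute)

text \<open>\<open>sprod\<close> truncates exponents at 2 and is the true product only for factors
  satisfying \<open>exp_le 2\<close>. Bounds add under multiplication, so the intermediate products
  in the reflection equation stay within this range.\<close>

definition exp_le :: "int \<Rightarrow> 'd::finite ser \<Rightarrow> bool" where
  "exp_le m F \<longleftrightarrow> (\<forall>a b. a > m \<or> b > m \<longrightarrow> F a b = (\<lambda>i j k l. 0))"

lemma exp_le_sprod:
  assumes "exp_le m F" "exp_le n G"
  shows "exp_le (m + n) (sprod \<kappa> s F G)"
proof -
  have "tmul3 \<kappa> s (F a b) (G (p - a) (q - b)) i j k l = 0" if "p > m + n \<or> q > m + n" for p q a b i j k l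
  proof -
    have "a > m \<or> b > m \<or> p - a > n \<or> q - b > n" using that by linarith
    then have "F a b = (\<lambda>i j k l. 0) \<or> G (p - a) (q - b) = (\<lambda>i j k l. 0)"
      using assms unfolding exp_le_def by blast
    then show ?thesis by auto
  qed
  then show ?thesis by (simp add: exp_le_def sprod_def fun_eq_iff)
qed

text \<open>The factor \<open>u\<close> shifts the first exponent, \<open>t v\<close> the second,
  and \<open>P\<close> exchanges \<open>i\<close> and \<open>k\<close>. If one of these terms falls
  outside the summation range of \<open>sprod\<close>, the bound on \<open>G\<close> makes its
  contribution zero.\<close>

lemma sprod_R_left:
  assumes "i \<in> {1..\<kappa>}" "k \<in> {1..\<kappa>}" "exp_le 2 G"
  shows "sprod \<kappa> s (Rspec t s) G p q i j k l = G (p-1) q i j k l + t *\<^sub>R G p (q-1) i j k l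
     - ((-1) ^ ((pty s i + pty s k) * (pty s k + pty s j)) * real_of_int (s k)) *\<^sub>R G p q k j i l"
proof -
  let ?A = "{p-2..2}" and ?B = "{q-2..2}"
  have "sprod \<kappa> s (Rspec t s) G p q i j k l =
     (\<Sum>a\<in>?A. \<Sum>b\<in>?B. (if a = 1 \<and> b = 0 then tmul3 \<kappa> s id3 (G (p-1) q) i j k l else 0))
   + (\<Sum>a\<in>?A. \<Sum>b\<in>?B. (if a = 0 \<and> b = 1 then t *\<^sub>R tmul3 \<kappa> s id3 (G p (q-1)) i j k l else 0))
   + (\<Sum>a\<in>?A. \<Sum>b\<in>?B. (if a = 0 \<and> b = 0 then - tmul3 \<kappa> s (Ptens s) (G p q) i j k l else 0))"
    unfolding sprod_def sum.distrib [symmetric]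
    by (intro sum.cong refl) (auto simp: Rspec_def tmul3_scaleR tmul3_uminus)
  then show ?thesis using assms
    by (auto simp: sum_sum_delta tmul3_id3_left tmul3_P_left exp_le_def)
qed

lemma sprod_R_right:
  assumes "j \<in> {1..\<kappa>}" "l \<in> {1..\<kappa>}" "exp_le 2 G"
  shows "sprod \<kappa> s G (Rspec t s) p q i j k l = G (p-1) q i j k l + t *\<^sub>R G p (q-1) i j k l
     - ((-1) ^ ((pty s k + pty s j) * (pty s j + pty s l)) * real_of_int (s j)) *\<^sub>R G p q i l k j"
proof -
  let ?A = "{p-2..2}" and ?B = "{q-2..2}"
  have "sprod \<kappa> s G (Rspec t s) p q i j k l =
     (\<Sum>a\<in>?A. \<Sum>b\<in>?B. (if a = p-1 \<and> b = q then tmul3 \<kappa> s (G (p-1) q) id3 i j k l else 0))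
   + (\<Sum>a\<in>?A. \<Sum>b\<in>?B. (if a = p \<and> b = q-1 then t *\<^sub>R tmul3 \<kappa> s (G p (q-1)) id3 i j k l else 0))
   + (\<Sum>a\<in>?A. \<Sum>b\<in>?B. (if a = p \<and> b = q then - tmul3 \<kappa> s (G p q) (Ptens s) i j k l else 0))"
    unfolding sprod_def sum.distrib [symmetric]
    by (intro sum.cong refl) (auto simp: Rspec_def tmul3_scaleR tmul3_uminus)
  then show ?thesis using assms
    by (auto simp: sum_sum_delta tmul3_id3_right tmul3_P_right exp_le_def)
qed

text \<open>The integer index \<open>r\<close> is the exponent of \<open>u\<^sup>-\<^sup>1\<close>, so that coefficients with \<open>r < 0\<close> vanish and
  the recursions obtained by comparing coefficients hold without side conditions.\<close>
definition bint :: "(nat \<Rightarrow> int) \<Rightarrow> (nat \<Rightarrow> nat \<Rightarrow> nat \<Rightarrow> 'd::finite op) \<Rightarrow> int \<Rightarrow> nat \<Rightarrow> nat \<Rightarrow> 'd op" where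
  "bint \<epsilon> \<rho> r i j = (if r < 0 then 0 else bcoef \<epsilon> \<rho> (nat r) i j)"

definition bsgn :: "(nat \<Rightarrow> int) \<Rightarrow> (nat \<Rightarrow> int) \<Rightarrow> (nat \<Rightarrow> nat \<Rightarrow> nat \<Rightarrow> 'd::finite op) \<Rightarrow> int \<Rightarrow> nat \<Rightarrow> nat \<Rightarrow> 'd op" where
  "bsgn s \<epsilon> \<rho> r i j = cB s i j *\<^sub>R bint \<epsilon> \<rho> r i j"

lemma bsgn_neg: "r < 0 \<Longrightarrow> bsgn s \<epsilon> \<rho> r i j = 0"
  by (simp add: bsgn_def bint_def)

lemma SB1_eq: "SB1 s \<epsilon> \<rho> a b i j k l = (if b = 0 \<and> k = l then bsgn s \<epsilon> \<rho> (- a) i j else 0)"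
  by (simp add: SB1_def bsgn_def bint_def)

lemma SB2_eq: "SB2 s \<epsilon> \<rho> a b i j k l = (if a = 0 \<and> i = j then bsgn s \<epsilon> \<rho> (- b) k l else 0)"
  by (simp add: SB2_def bsgn_def bint_def)

lemma exp_le_SB1: "exp_le 0 (SB1 s \<epsilon> \<rho>)" and exp_le_SB2: "exp_le 0 (SB2 s \<epsilon> \<rho>)"
  and exp_le_Rspec: "exp_le 1 (Rspec t s)"
  by (auto simp: exp_le_def SB1_def SB2_def Rspec_def)

lemma exp_le_mono: "exp_le m F \<Longrightarrow> m \<le> n \<Longrightarrow> exp_le n F"
  unfolding exp_le_def by (meson le_less_trans)

lemma tmul3_SB2_right:
  assumes "j \<in> {1..\<kappa>}"
  shows "tmul3 \<kappa> s T (SB2 s \<epsilon> \<rho> 0 e) i j k l = (\<Sum>c\<in>{1..\<kappa>}.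
     (-1) ^ ((pty s k + pty s c) * (pty s c + pty s l) + (pty s i + pty s j) * (pty s c + pty s l))
      *\<^sub>R (T i j k c ** bsgn s \<epsilon> \<rho> (- e) c l))"
proof -
  let ?t = "\<lambda>c. (-1) ^ ((pty s k + pty s c) * (pty s c + pty s l) + (pty s i + pty s j) * (pty s c + pty s l))
      *\<^sub>R (T i j k c ** bsgn s \<epsilon> \<rho> (- e) c l)"
  have "tmul3 \<kappa> s T (SB2 s \<epsilon> \<rho> 0 e) i j k l = (\<Sum>j0\<in>{1..\<kappa>}. \<Sum>c\<in>{1..\<kappa>}. if j0 = j then ?t c else 0)"
    unfolding tmul3_def SB2_eq
    by (intro sum.cong refl) (auto simp: minus_one_power_iff)
  also have "\<dots> = (\<Sum>c\<in>{1..\<kappa>}. \<Sum>j0\<in>{1..\<kappa>}. if j0 = j then ?t c else 0)"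
    by (rule sum.swap)
  finally show ?thesis using assms by simp
qed

lemma tmul3_SB1_right:
  assumes "l \<in> {1..\<kappa>}"
  shows "tmul3 \<kappa> s T (SB1 s \<epsilon> \<rho> e 0) i j k l = (\<Sum>c\<in>{1..\<kappa>}.
     (-1) ^ ((pty s i + pty s c) * (pty s c + pty s j) + (pty s k + pty s l) * (pty s l + pty s l))
      *\<^sub>R (T i c k l ** bsgn s \<epsilon> \<rho> (- e) c j))"
proof -
  let ?t = "\<lambda>c. (-1) ^ ((pty s i + pty s c) * (pty s c + pty s j) + (pty s k + pty s l) * (pty s l + pty s l))
      *\<^sub>R (T i c k l ** bsgn s \<epsilon> \<rho> (- e) c j)"
  have "tmul3 \<kappa> s T (SB1 s \<epsilon> \<rho> e 0) i j k l = (\<Sum>c\<in>{1..\<kappa>}. \<Sum>l0\<in>{1..\<kappa>}. if l0 = l then ?t c else 0)"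
    unfolding tmul3_def SB1_eq
    by (intro sum.cong refl) (auto simp: minus_one_power_iff)
  then show ?thesis using assms by simp
qed

text \<open>Meant for \<open>F\<close> equal to \<open>((u - v) - P) B_1(u) ((u + v) - P)\<close>,
  which is a polynomial of degree at most 2 in \<open>v\<close>; therefore three values of
  \<open>b\<close> suffice.\<close>

lemma sprod_SB2_right:
  assumes j: "j \<in> {1..\<kappa>}" and F: "exp_le 2 F" and z: "\<And>b c. c \<in> {1..\<kappa>} \<Longrightarrow> b < 0 \<Longrightarrow> F p b i j k c = 0"
  shows "sprod \<kappa> s F (SB2 s \<epsilon> \<rho>) p q i j k l = (\<Sum>b\<in>{0,1,2}. \<Sum>c\<in>{1..\<kappa>}.
     (-1) ^ ((pty s k + pty s c) * (pty s c + pty s l) + (pty s i + pty s j) * (pty s c + pty s l))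
      *\<^sub>R (F p b i j k c ** bsgn s \<epsilon> \<rho> (b - q) c l))"
proof -
  let ?t = "\<lambda>b. tmul3 \<kappa> s (F p b) (SB2 s \<epsilon> \<rho> 0 (q - b)) i j k l"
  have SB0: "SB2 s \<epsilon> \<rho> a b = (\<lambda>i j k l. 0)" if "a \<noteq> 0 \<or> b > 0" for a b
    using that by (auto simp: SB2_def)
  have "sprod \<kappa> s F (SB2 s \<epsilon> \<rho>) p q i j k l = (\<Sum>a\<in>{p-2..2}. \<Sum>b\<in>{q-2..2}. if a = p then ?t b else 0)"
    unfolding sprod_def by (intro sum.cong refl) (auto simp: SB0)
  also have "\<dots> = (\<Sum>b\<in>{q-2..2}. \<Sum>a\<in>{p-2..2}. if a = p then ?t b else 0)"
    by (rule sum.swap)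
  also have "\<dots> = (\<Sum>b\<in>{q-2..2}. ?t b)"
    using F by (intro sum.cong refl) (auto simp: exp_le_def)
  also have "\<dots> = (\<Sum>b\<in>{q-2..2} \<union> {0,1,2}. ?t b)"
    by (rule sum.mono_neutral_left) (auto simp: SB0)
  also have "\<dots> = (\<Sum>b\<in>{0,1,2}. ?t b)"
  proof (rule sum.mono_neutral_right)
    show "\<forall>b\<in>({q-2..2} \<union> {0,1,2}) - {0,1,2}. ?t b = 0"
    proof
      fix b assume "b \<in> ({q-2..2} \<union> {0,1,2}) - {0,1,2}"
      then have "b < 0" by auto
      then show "?t b = 0" using z by (simp add: tmul3_SB2_right[OF j])
    qed
  qed auto
  finally show ?thesis by (simp add: tmul3_SB2_right[OF j])
qed

text \<open>Meant for \<open>F\<close> equal to \<open>B_2(v) ((u + v) - P)\<close>, which has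
  degree at most 1 in \<open>u\<close>.\<close>

lemma sprod_SB1_right:
  assumes l: "l \<in> {1..\<kappa>}" and F: "exp_le 2 F"
    and z: "\<And>a c. c \<in> {1..\<kappa>} \<Longrightarrow> a < 0 \<or> a > 1 \<Longrightarrow> F a q i c k l = 0"
  shows "sprod \<kappa> s F (SB1 s \<epsilon> \<rho>) p q i j k l = (\<Sum>a\<in>{0,1}. \<Sum>c\<in>{1..\<kappa>}.
     (-1) ^ ((pty s i + pty s c) * (pty s c + pty s j) + (pty s k + pty s l) * (pty s l + pty s l))
      *\<^sub>R (F a q i c k l ** bsgn s \<epsilon> \<rho> (a - p) c j))"
proof -
  let ?t = "\<lambda>a. tmul3 \<kappa> s (F a q) (SB1 s \<epsilon> \<rho> (p - a) 0) i j k l"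
  have SB0: "SB1 s \<epsilon> \<rho> a b = (\<lambda>i j k l. 0)" if "a > 0 \<or> b \<noteq> 0" for a b
    using that by (auto simp: SB1_def)
  have "sprod \<kappa> s F (SB1 s \<epsilon> \<rho>) p q i j k l = (\<Sum>a\<in>{p-2..2}. \<Sum>b\<in>{q-2..2}. if b = q then ?t a else 0)"
    unfolding sprod_def by (intro sum.cong refl) (auto simp: SB0)
  also have "\<dots> = (\<Sum>a\<in>{p-2..2}. ?t a)"
    using F by (intro sum.cong refl) (auto simp: exp_le_def)
  also have "\<dots> = (\<Sum>b\<in>{p-2..2} \<union> {0,1}. ?t b)"
    by (rule sum.mono_neutral_left) (auto simp: SB0)
  also have "\<dots> = (\<Sum>b\<in>{0,1}. ?t b)"
  proof (rule sum.mono_neutral_right)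
    show "\<forall>b\<in>({p-2..2} \<union> {0,1}) - {0,1}. ?t b = 0"
    proof
      fix b assume "b \<in> ({p-2..2} \<union> {0,1}) - {0,1}"
      then have "b < 0 \<or> b > 1" by auto
      then show "?t b = 0" using z by (simp add: tmul3_SB1_right[OF l])
    qed
  qed auto
  finally show ?thesis by (simp add: tmul3_SB1_right[OF l])
qed

text \<open>The sign created by multiplication with \<open>P\<close>, on the left for row indices
  and on the right for column indices.\<close>

definition flip_sgn :: "(nat \<Rightarrow> int) \<Rightarrow> nat \<Rightarrow> nat \<Rightarrow> nat \<Rightarrow> real" where
  "flip_sgn s i k j = (-1) ^ ((pty s i + pty s k) * (pty s k + pty s j))"

text \<open>The Koszul sign for moving the coefficient \<open>b_cl\<close> of \<open>B_2(v)\<close>,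
  of parity \<open>|c| + |l|\<close>, past \<open>E_ij\<close> and \<open>E_kc\<close>.\<close>

definition mult_sgn :: "(nat \<Rightarrow> int) \<Rightarrow> nat \<Rightarrow> nat \<Rightarrow> nat \<Rightarrow> nat \<Rightarrow> nat \<Rightarrow> real" where
  "mult_sgn s i j k c l = (-1) ^ ((pty s k + pty s c) * (pty s c + pty s l) + (pty s i + pty s j) * (pty s c + pty s l))"

section \<open>Entries of the two sides of the reflection equation\<close>

lemma sprod_RB1:
  assumes "i \<in> {1..\<kappa>}" "k \<in> {1..\<kappa>}"
  shows "sprod \<kappa> s (Rspec (-1) s) (SB1 s \<epsilon> \<rho>) p b i j k l =
     (if b = 0 \<and> k = l then bsgn s \<epsilon> \<rho> (1 - p) i j else 0) - (if b = 1 \<and> k = l then bsgn s \<epsilon> \<rho> (- p) i j else 0)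
     - (if b = 0 \<and> i = l then (flip_sgn s i k j * real_of_int (s k)) *\<^sub>R bsgn s \<epsilon> \<rho> (- p) k j else 0)"
  using assms by (subst sprod_R_left) (auto simp: exp_le_mono[OF exp_le_SB1] SB1_eq flip_sgn_def)

lemma exp_le_RB1: "exp_le 1 (sprod \<kappa> s (Rspec t s) (SB1 s \<epsilon> \<rho>))"
  using exp_le_sprod[OF exp_le_Rspec exp_le_SB1] by simp

text \<open>Since \<open>(u - v)(u + v) = u^2 - v^2\<close> has no mixed term, the coefficient of
  \<open>v\<close> consists of the terms that contain \<open>P\<close> exactly once, and that of
  \<open>v^2\<close> is \<open>-B_1(u)\<close>.\<close>

lemma sprod_RB1R:
  fixes s \<epsilon> :: "nat \<Rightarrow> int" and \<rho> :: "nat \<Rightarrow> nat \<Rightarrow> nat \<Rightarrow> 'd::finite op"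
  assumes "i \<in> {1..\<kappa>}" "j \<in> {1..\<kappa>}" "k \<in> {1..\<kappa>}" "c \<in> {1..\<kappa>}"
  defines "N \<equiv> sprod \<kappa> s (sprod \<kappa> s (Rspec (-1) s) (SB1 s \<epsilon> \<rho>)) (Rspec 1 s)"
  shows "N p 0 i j k c = (if k = c then bsgn s \<epsilon> \<rho> (2 - p) i j else 0)
         - (if i = c then (flip_sgn s i k j * real_of_int (s k)) *\<^sub>R bsgn s \<epsilon> \<rho> (1 - p) k j else 0)
         - (if k = j then (flip_sgn s k j c * real_of_int (s j)) *\<^sub>R bsgn s \<epsilon> \<rho> (1 - p) i c else 0)
         + (if i = j then (flip_sgn s k j c * real_of_int (s j) * flip_sgn s i k c * real_of_int (s k)) *\<^sub>R bsgn s \<epsilon> \<rho> (- p) k c else 0)" (is ?A)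
    and "N p 1 i j k c = - (if i = c then (flip_sgn s i k j * real_of_int (s k)) *\<^sub>R bsgn s \<epsilon> \<rho> (- p) k j else 0)
         + (if k = j then (flip_sgn s k j c * real_of_int (s j)) *\<^sub>R bsgn s \<epsilon> \<rho> (- p) i c else 0)" (is ?B)
    and "N p 2 i j k c = - (if k = c then bsgn s \<epsilon> \<rho> (- p) i j else 0)" (is ?C)
    and "b < 0 \<Longrightarrow> N p b i j k c = 0"
proof -
  have N: "N p b i j k c = sprod \<kappa> s (Rspec (-1) s) (SB1 s \<epsilon> \<rho>) (p-1) b i j k c + sprod \<kappa> s (Rspec (-1) s) (SB1 s \<epsilon> \<rho>) p (b-1) i j k c
     - (flip_sgn s k j c * real_of_int (s j)) *\<^sub>R sprod \<kappa> s (Rspec (-1) s) (SB1 s \<epsilon> \<rho>) p b i c k j" for b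
    unfolding N_def using assms(1-4) exp_le_mono[OF exp_le_RB1, of 2] by (subst sprod_R_right) (auto simp: flip_sgn_def)
  show ?A ?B ?C "b < 0 \<Longrightarrow> N p b i j k c = 0"
    unfolding N using assms(1-4) by (simp_all add: sprod_RB1 scaleR_diff_right)
qed

lemma sprod_B2R:
  assumes "c \<in> {1..\<kappa>}" "l \<in> {1..\<kappa>}"
  shows "sprod \<kappa> s (SB2 s \<epsilon> \<rho>) (Rspec 1 s) a q i c k l =
      (if a = 1 \<and> i = c then bsgn s \<epsilon> \<rho> (- q) k l else 0) + (if a = 0 \<and> i = c then bsgn s \<epsilon> \<rho> (1 - q) k l else 0)
       - (if a = 0 \<and> i = l then (flip_sgn s k c l * real_of_int (s c)) *\<^sub>R bsgn s \<epsilon> \<rho> (- q) k c else 0)"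
  using assms by (subst sprod_R_right) (auto simp: exp_le_mono[OF exp_le_SB2] SB2_eq flip_sgn_def)

lemma exp_le_B2R: "exp_le 1 (sprod \<kappa> s (SB2 s \<epsilon> \<rho>) (Rspec t s))"
  using exp_le_sprod[OF exp_le_SB2 exp_le_Rspec] by simp

lemma sprod_B2RB1:
  assumes "i \<in> {1..\<kappa>}" "l \<in> {1..\<kappa>}"
  shows "sprod \<kappa> s (sprod \<kappa> s (SB2 s \<epsilon> \<rho>) (Rspec 1 s)) (SB1 s \<epsilon> \<rho>) p q i j k l =
      bsgn s \<epsilon> \<rho> (1 - q) k l ** bsgn s \<epsilon> \<rho> (- p) i j + bsgn s \<epsilon> \<rho> (- q) k l ** bsgn s \<epsilon> \<rho> (1 - p) i j
       - (if i = l then \<Sum>c\<in>{1..\<kappa>}. (flip_sgn s i c j * flip_sgn s k c l * real_of_int (s c)) *\<^sub>R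
            (bsgn s \<epsilon> \<rho> (- q) k c ** bsgn s \<epsilon> \<rho> (- p) c j) else 0)"
proof -
  let ?G = "sprod \<kappa> s (SB2 s \<epsilon> \<rho>) (Rspec 1 s)"
  have g: "(-1) ^ ((pty s i + pty s c) * (pty s c + pty s j) + (pty s k + pty s l) * (pty s l + pty s l)) = flip_sgn s i c j" for c
  proof -
    have "even ((pty s k + pty s l) * (pty s l + pty s l))" by simp
    then show ?thesis unfolding flip_sgn_def power_add by simp
  qed
  have "sprod \<kappa> s ?G (SB1 s \<epsilon> \<rho>) p q i j k l = (\<Sum>a\<in>{0,1}. \<Sum>c\<in>{1..\<kappa>}.
        flip_sgn s i c j *\<^sub>R (?G a q i c k l ** bsgn s \<epsilon> \<rho> (a - p) c j))"
    using assms by (subst sprod_SB1_right) (auto simp: exp_le_mono[OF exp_le_B2R] sprod_B2R g)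
  also have "\<dots> = (\<Sum>c\<in>{1..\<kappa>}. if c = i then flip_sgn s i c j *\<^sub>R (bsgn s \<epsilon> \<rho> (- q) k l ** bsgn s \<epsilon> \<rho> (1 - p) c j) else 0)
     + (\<Sum>c\<in>{1..\<kappa>}. if c = i then flip_sgn s i c j *\<^sub>R (bsgn s \<epsilon> \<rho> (1 - q) k l ** bsgn s \<epsilon> \<rho> (- p) c j) else 0)
     - (\<Sum>c\<in>{1..\<kappa>}. if i = l then (flip_sgn s i c j * flip_sgn s k c l * real_of_int (s c)) *\<^sub>R
            (bsgn s \<epsilon> \<rho> (- q) k c ** bsgn s \<epsilon> \<rho> (- p) c j) else 0)"
    unfolding sum.distrib [symmetric] sum_subtractf [symmetric]
    using assms by (auto simp flip: sum.distrib intro!: sum.cong simp: sprod_B2R matrix_mult_add scaleR_matrix_mult algebra_simps)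
  finally show ?thesis using assms by (simp add: flip_sgn_def)
qed

text \<open>Multiply the three \<open>v\<close>-coefficients of \<open>N\<close> by
  \<open>B_2(v)\<close>. Deltas that involve the inner index \<open>c\<close> collapse the sum to
  one product; the deltas \<open>k = j\<close> and \<open>i = j\<close> leave genuine matrix
  products over \<open>c\<close>.\<close>

lemma sprod_RB1RB2:
  fixes s \<epsilon> :: "nat \<Rightarrow> int" and \<rho> :: "nat \<Rightarrow> nat \<Rightarrow> nat \<Rightarrow> 'd::finite op"
  assumes "i \<in> {1..\<kappa>}" "j \<in> {1..\<kappa>}" "k \<in> {1..\<kappa>}" "l \<in> {1..\<kappa>}"
  defines "N \<equiv> sprod \<kappa> s (sprod \<kappa> s (Rspec (-1) s) (SB1 s \<epsilon> \<rho>)) (Rspec 1 s)"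
    and "b \<equiv> bsgn s \<epsilon> \<rho>"
  shows "sprod \<kappa> s N (SB2 s \<epsilon> \<rho>) (- r) (- q) i j k l =
     mult_sgn s i j k k l *\<^sub>R (b (r+2) i j ** b q k l - b r i j ** b (q+2) k l)
   - (mult_sgn s i j k i l * flip_sgn s i k j * real_of_int (s k)) *\<^sub>R (b (r+1) k j ** b q i l + b r k j ** b (q+1) i l)
   - (if k = j then \<Sum>c\<in>{1..\<kappa>}. (mult_sgn s i j k c l * flip_sgn s k j c * real_of_int (s j)) *\<^sub>R (b (r+1) i c ** b q c l - b r i c ** b (q+1) c l) else 0)
   + (if i = j then \<Sum>c\<in>{1..\<kappa>}. (mult_sgn s i j k c l * flip_sgn s k j c * real_of_int (s j) * flip_sgn s i k c * real_of_int (s k)) *\<^sub>R (b r k c ** b q c l) else 0)"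
proof -
  have bN: "exp_le 2 N" unfolding N_def using exp_le_sprod[OF exp_le_RB1 exp_le_Rspec] by simp
  have "sprod \<kappa> s N (SB2 s \<epsilon> \<rho>) (- r) (- q) i j k l = (\<Sum>a\<in>{0,1,2}. \<Sum>c\<in>{1..\<kappa>}.
      mult_sgn s i j k c l *\<^sub>R (N (-r) a i j k c ** b (a + q) c l))"
    unfolding b_def using assms bN by (subst sprod_SB2_right) (auto simp: sprod_RB1R mult_sgn_def)
  also have "\<dots> = (\<Sum>c\<in>{1..\<kappa>}. mult_sgn s i j k c l *\<^sub>R (N (-r) 0 i j k c ** b q c l + N (-r) 1 i j k c ** b (q+1) c l
      + N (-r) 2 i j k c ** b (q+2) c l))"
    by (simp add: sum.distrib scaleR_add_right add.commute)
  also have "\<dots> = (\<Sum>c\<in>{1..\<kappa>}. if c = k then mult_sgn s i j k c l *\<^sub>R (b (r+2) i j ** b q c l - b r i j ** b (q+2) c l) else 0)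
   - (\<Sum>c\<in>{1..\<kappa>}. if c = i then (mult_sgn s i j k c l * flip_sgn s i k j * real_of_int (s k)) *\<^sub>R (b (r+1) k j ** b q c l + b r k j ** b (q+1) c l) else 0)
   - (\<Sum>c\<in>{1..\<kappa>}. if k = j then (mult_sgn s i j k c l * flip_sgn s k j c * real_of_int (s j)) *\<^sub>R (b (r+1) i c ** b q c l - b r i c ** b (q+1) c l) else 0)
   + (\<Sum>c\<in>{1..\<kappa>}. if i = j then (mult_sgn s i j k c l * flip_sgn s k j c * real_of_int (s j) * flip_sgn s i k c * real_of_int (s k)) *\<^sub>R (b r k c ** b q c l) else 0)"
    unfolding sum.distrib [symmetric] sum_subtractf [symmetric]
  proof (rule sum.cong [OF refl])
    fix c assume c: "c \<in> {1..\<kappa>}"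
    show "mult_sgn s i j k c l *\<^sub>R (N (-r) 0 i j k c ** b q c l + N (-r) 1 i j k c ** b (q+1) c l
      + N (-r) 2 i j k c ** b (q+2) c l) =
      (if c = k then mult_sgn s i j k c l *\<^sub>R (b (r+2) i j ** b q c l - b r i j ** b (q+2) c l) else 0)
   - (if c = i then (mult_sgn s i j k c l * flip_sgn s i k j * real_of_int (s k)) *\<^sub>R (b (r+1) k j ** b q c l + b r k j ** b (q+1) c l) else 0)
   - (if k = j then (mult_sgn s i j k c l * flip_sgn s k j c * real_of_int (s j)) *\<^sub>R (b (r+1) i c ** b q c l - b r i c ** b (q+1) c l) else 0)
   + (if i = j then (mult_sgn s i j k c l * flip_sgn s k j c * real_of_int (s j) * flip_sgn s i k c * real_of_int (s k)) *\<^sub>R (b r k c ** b q c l) else 0)"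
      unfolding N_def sprod_RB1R[OF assms(1-3) c] b_def [symmetric]
      by (cases "c = k"; cases "c = i"; cases "k = j"; cases "i = j")
         (simp_all add: matrix_mult_add scaleR_matrix_mult matrix_mult_uminus scaleR_add_right scaleR_diff_right matrix_mult_two ac_simps)
  qed
  finally show ?thesis using assms by simp
qed

text \<open>Cancels factors such as \<open>u - v - c\<close> or \<open>u + v - c\<close> from identities between series in
  \<open>u\<^sup>-\<^sup>1\<close> and \<open>v\<^sup>-\<^sup>1\<close>: the coefficients are determined recursively in \<open>r\<close>.\<close>
lemma series_zero:
  fixes f :: "int \<Rightarrow> int \<Rightarrow> 'a::zero"
  assumes "\<And>r q. r < N \<Longrightarrow> f r q = 0"
    and "\<And>r q. N \<le> r \<Longrightarrow> (\<And>r' q. r' < r \<Longrightarrow> f r' q = 0) \<Longrightarrow> f r q = 0"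
  shows "f r q = 0"
proof -
  have "\<forall>q. f (N + int n) q = 0" for n
  proof (induction n rule: less_induct)
    case (less n)
    have "f r' q = 0" if "r' < N + int n" for r' q
    proof (cases "r' < N")
      case False
      then have "r' = N + int (nat (r' - N))" "nat (r' - N) < n" using that by linarith+
      then show ?thesis using less[of "nat (r' - N)"] by auto
    qed (simp add: assms(1))
    then show ?case using assms(2)[of "N + int n"] by simp
  qed
  then show ?thesis using assms(1)[of r q] by (cases "r < N") (simp, metis add_diff_cancel_left' diff_add_cancel add.commute int_nat_eq linorder_not_less diff_ge_0_iff_ge)
qed

section \<open>Relations between the coefficients of the series\<close>

locale refl_alg =
  fixes \<kappa> :: nat and s \<epsilon> :: "nat \<Rightarrow> int" and \<rho> :: "nat \<Rightarrow> nat \<Rightarrow> nat \<Rightarrow> 'd::finite op"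
  assumes s_cases: "i \<in> {1..\<kappa>} \<Longrightarrow> s i = 1 \<or> s i = -1"
    and eps_cases: "i \<in> {1..\<kappa>} \<Longrightarrow> \<epsilon> i = 1 \<or> \<epsilon> i = -1"
    and reflection: "reflection_rel \<kappa> s \<epsilon> \<rho>"
begin

abbreviation "b \<equiv> bint \<epsilon> \<rho>"
abbreviation "b' \<equiv> bsgn s \<epsilon> \<rho>"
abbreviation "sr i \<equiv> real_of_int (s i)"

text \<open>Coefficient of \<open>u\<^sup>-\<^sup>r v\<^sup>-\<^sup>q\<close> in the reflection equation multiplied by \<open>(u - v)(u + v)\<close>.\<close>
lemma reflection_components:
  assumes "i \<in> {1..\<kappa>}" "j \<in> {1..\<kappa>}" "k \<in> {1..\<kappa>}" "l \<in> {1..\<kappa>}"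
  shows "mult_sgn s i j k k l *\<^sub>R (b' (r+2) i j ** b' q k l - b' r i j ** b' (q+2) k l)
   - (mult_sgn s i j k i l * flip_sgn s i k j * sr k) *\<^sub>R (b' (r+1) k j ** b' q i l + b' r k j ** b' (q+1) i l)
   - (if k = j then \<Sum>c\<in>{1..\<kappa>}. (mult_sgn s i j k c l * flip_sgn s k j c * sr j) *\<^sub>R (b' (r+1) i c ** b' q c l - b' r i c ** b' (q+1) c l) else 0)
   + (if i = j then \<Sum>c\<in>{1..\<kappa>}. (mult_sgn s i j k c l * flip_sgn s k j c * sr j * flip_sgn s i k c * sr k) *\<^sub>R (b' r k c ** b' q c l) else 0)
  = (b' q k l ** b' (r+2) i j - b' (q+2) k l ** b' r i j)
   - (if i = l then \<Sum>c\<in>{1..\<kappa>}. (flip_sgn s i c j * flip_sgn s k c l * sr c) *\<^sub>R (b' q k c ** b' (r+1) c j - b' (q+1) k c ** b' r c j) else 0)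
   - (flip_sgn s k j l * sr j) *\<^sub>R (b' (q+1) k j ** b' r i l + b' q k j ** b' (r+1) i l)
   + (if i = j then \<Sum>c\<in>{1..\<kappa>}. (flip_sgn s k j l * sr j * flip_sgn s i c l * flip_sgn s k c j * sr c) *\<^sub>R (b' q k c ** b' r c l) else 0)"
   (is "?L = ?R")
proof -
  let ?X = "sprod \<kappa> s (sprod \<kappa> s (SB2 s \<epsilon> \<rho>) (Rspec 1 s)) (SB1 s \<epsilon> \<rho>)"
  have bX: "exp_le 2 ?X"
    using exp_le_mono[OF exp_le_sprod[OF exp_le_B2R exp_le_SB1], of 2] by simp
  have "?L = sprod \<kappa> s ?X (Rspec (-1) s) (- r) (- q) i j k l"
    using reflection assms unfolding reflection_rel_def Rminus_Rplus_eq by (simp only: sprod_RB1RB2 [OF assms, symmetric])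
  also have "\<dots> = ?X (- r - 1) (- q) i j k l - ?X (- r) (- q - 1) i j k l - (flip_sgn s k j l * sr j) *\<^sub>R ?X (- r) (- q) i l k j"
    using assms bX by (subst sprod_R_right) (auto simp: flip_sgn_def)
  also have "\<dots> = ?R"
    using assms by (simp add: sprod_B2RB1 scaleR_diff_right scaleR_add_right scaleR_sum_right sum_subtractf algebra_simps)
  finally show ?thesis .
qed

text \<open>The \<open>(k,k)\<close> entry of \<open>B(u) B(v)\<close> at \<open>u^-r v^-q\<close>:
  the sign of the super tensor product cancels the two signs in \<open>B\<close>, so none
  remains.\<close>

definition "bprod k r q = (\<Sum>c\<in>{1..\<kappa>}. b r k c ** b q c k)"
definition "bprod_alt k r q = bprod k r q - bprod k q r"
definition "bcomm k r q = b r k k ** b q k k - b q k k ** b r k k"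

lemma b_neg: "r < 0 \<Longrightarrow> b r i j = 0"
  by (simp add: bint_def)

lemma b'_conv: "i \<in> {1..\<kappa>} \<Longrightarrow> j \<in> {1..\<kappa>} \<Longrightarrow> b' r i j = (if s i = 1 \<and> s j = -1 then - b r i j else b r i j)"
  using s_cases[of i] s_cases[of j] by (auto simp: bsgn_def cB_def pty_def)

text \<open>With all indices equal, each of the four sums over \<open>c\<close> in the reflection
  equation is, after cancellation of signs, a diagonal entry of \<open>B(u) B(v)\<close> or
  \<open>B(v) B(u)\<close>.\<close>

lemma refl_kkkk:
  assumes k: "k \<in> {1..\<kappa>}"
  shows "bcomm k (r+2) q - bcomm k r (q+2) = sr k *\<^sub>R (bcomm k (r+1) q + bcomm k r (q+1))
     + sr k *\<^sub>R (bprod_alt k (r+1) q - bprod_alt k r (q+1)) - bprod_alt k r q"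
proof -
  have bk: "b' r k k = b r k k" for r using k by (auto simp: b'_conv)
  have t1: "(\<Sum>c\<in>{1..\<kappa>}. (mult_sgn s k k k c k * flip_sgn s k k c * sr k) *\<^sub>R (b' (r+1) k c ** b' q c k - b' r k c ** b' (q+1) c k))
     = sr k *\<^sub>R (bprod k (r+1) q - bprod k r (q+1))"
    unfolding bprod_def sum_subtractf [symmetric] scaleR_sum_right
    by (rule sum.cong [OF refl], frule s_cases, insert k s_cases[OF k])
      (auto simp: b'_conv mult_sgn_def flip_sgn_def pty_def matrix_mult_uminus)
  have t2: "(\<Sum>c\<in>{1..\<kappa>}. (mult_sgn s k k k c k * flip_sgn s k k c * sr k * flip_sgn s k k c * sr k) *\<^sub>R (b' r k c ** b' q c k)) = bprod k r q"
    unfolding bprod_def sum_subtractf [symmetric] scaleR_sum_right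
    by (rule sum.cong [OF refl], frule s_cases, insert k s_cases[OF k])
      (auto simp: b'_conv mult_sgn_def flip_sgn_def pty_def matrix_mult_uminus)
  have t3: "(\<Sum>c\<in>{1..\<kappa>}. (flip_sgn s k c k * flip_sgn s k c k * sr c) *\<^sub>R (b' q k c ** b' (r+1) c k - b' (q+1) k c ** b' r c k))
     = sr k *\<^sub>R (bprod k q (r+1) - bprod k (q+1) r)"
    unfolding bprod_def sum_subtractf [symmetric] scaleR_sum_right
    by (rule sum.cong [OF refl], frule s_cases, insert k s_cases[OF k])
      (auto simp: b'_conv mult_sgn_def flip_sgn_def pty_def matrix_mult_uminus)
  have t4: "(\<Sum>c\<in>{1..\<kappa>}. (flip_sgn s k k k * sr k * flip_sgn s k c k * flip_sgn s k c k * sr c) *\<^sub>R (b' q k c ** b' r c k)) = bprod k q r"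
    unfolding bprod_def sum_subtractf [symmetric] scaleR_sum_right
    by (rule sum.cong [OF refl], frule s_cases, insert k s_cases[OF k])
      (auto simp: b'_conv mult_sgn_def flip_sgn_def pty_def matrix_mult_uminus)
  have c: "mult_sgn s k k k k k = 1" "flip_sgn s k k k = 1" by (simp_all add: mult_sgn_def flip_sgn_def minus_one_power_iff)
  from reflection_components[OF k k k k, of r q, simplified if_True refl simp_thms t1 t2 t3 t4, unfolded c bk]
  show ?thesis unfolding bcomm_def bprod_alt_def by (simp add: algebra_simps)
qed

text \<open>The constants stay unspecified: for \<open>i < k\<close> every product they multiply
  begins by applying some \<open>b_ik\<close>, hence vanishes on singular vectors.\<close>

lemma refl_iikk:
  assumes i: "i \<in> {1..\<kappa>}" and k: "k \<in> {1..\<kappa>}" and "i \<noteq> k"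
  obtains c1 c2 where "(b (r+2) i i ** b q k k - b r i i ** b (q+2) k k) - (b q k k ** b (r+2) i i - b (q+2) k k ** b r i i)
    = c1 *\<^sub>R (b (r+1) k i ** b q i k + b r k i ** b (q+1) i k)
     - c2 *\<^sub>R (b (q+1) k i ** b r i k + b q k i ** b (r+1) i k) - bprod_alt k r q"
proof -
  have bk: "b' r k k = b r k k" "b' r i i = b r i i" for r using k i by (auto simp: b'_conv)
  obtain e where e: "\<And>r q. b' r k i ** b' q i k = e *\<^sub>R (b r k i ** b q i k)"
    by (rule that[of "cB s k i * cB s i k"]) (simp add: bsgn_def scaleR_matrix_mult mult.commute)
  have t2: "(\<Sum>c\<in>{1..\<kappa>}. (mult_sgn s i i k c k * flip_sgn s k i c * sr i * flip_sgn s i k c * sr k) *\<^sub>R (b' r k c ** b' q c k)) = bprod k r q"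
    unfolding bprod_def sum_subtractf [symmetric] scaleR_sum_right
    by (rule sum.cong [OF refl], frule s_cases, insert k i s_cases[OF k] s_cases[OF i])
      (auto simp: b'_conv mult_sgn_def flip_sgn_def pty_def matrix_mult_uminus)
  have t4: "(\<Sum>c\<in>{1..\<kappa>}. (flip_sgn s k i k * sr i * flip_sgn s i c k * flip_sgn s k c i * sr c) *\<^sub>R (b' q k c ** b' r c k)) = bprod k q r"
    unfolding bprod_def sum_subtractf [symmetric] scaleR_sum_right
    by (rule sum.cong [OF refl], frule s_cases, insert k i s_cases[OF k] s_cases[OF i])
      (auto simp: b'_conv mult_sgn_def flip_sgn_def pty_def matrix_mult_uminus)
  have c: "mult_sgn s i i k k k = 1" by (simp_all add: mult_sgn_def flip_sgn_def minus_one_power_iff)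
  from reflection_components[OF i i k k, of r q, simplified if_True refl simp_thms t2 t4, unfolded c bk e] \<open>i \<noteq> k\<close>
  show ?thesis unfolding bprod_alt_def
    by (intro that[of "mult_sgn s i i k i k * flip_sgn s i k i * sr k * e" "flip_sgn s k i k * sr i * e"]) (simp add: bprod_alt_def algebra_simps)
qed

text \<open>The source of the relation for \<open>b_ka(u) b_ak(v)\<close> with \<open>k < a\<close>.
  The products multiplied by \<open>c1\<close> apply \<open>b_ka\<close> first, so they vanish on
  singular vectors.\<close>

lemma refl_kaak:
  assumes a: "a \<in> {1..\<kappa>}" and k: "k \<in> {1..\<kappa>}" and "a \<noteq> k"
  obtains c1 where "b (r+2) k a ** b q a k - b r k a ** b (q+2) a k
    = c1 *\<^sub>R (b q a k ** b (r+2) k a - b (q+2) a k ** b r k a)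
     + sr a *\<^sub>R (b (r+1) a a ** b q k k + b r a a ** b (q+1) k k - (b (q+1) a a ** b r k k + b q a a ** b (r+1) k k))
     + sr a *\<^sub>R (bprod k (r+1) q - bprod k r (q+1) - bprod a q (r+1) + bprod a (q+1) r)"
proof -
  have bk: "b' r k k = b r k k" "b' r a a = b r a a" for r using k a by (auto simp: b'_conv)
  define e where "e = cB s k a * cB s a k"
  have e: "b' r k a ** b' q a k = e *\<^sub>R (b r k a ** b q a k)" "b' r a k ** b' q k a = e *\<^sub>R (b r a k ** b q k a)" for r q
    by (simp_all add: bsgn_def scaleR_matrix_mult mult.commute e_def)
  have we: "mult_sgn s k a a a k *\<^sub>R (e *\<^sub>R X - e *\<^sub>R Y) = X - Y" for X Y :: "'d op"
    using s_cases[OF k] s_cases[OF a] by (auto simp: e_def mult_sgn_def cB_def pty_def)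
  have t1: "(\<Sum>c\<in>{1..\<kappa>}. (mult_sgn s k a a c k * flip_sgn s a a c * sr a) *\<^sub>R (b' (r+1) k c ** b' q c k - b' r k c ** b' (q+1) c k))
     = sr a *\<^sub>R (bprod k (r+1) q - bprod k r (q+1))"
    unfolding bprod_def sum_subtractf [symmetric] scaleR_sum_right
    by (rule sum.cong [OF refl], frule s_cases, insert k a s_cases[OF k] s_cases[OF a])
      (auto simp: b'_conv mult_sgn_def flip_sgn_def pty_def matrix_mult_uminus)
  have t3: "(\<Sum>c\<in>{1..\<kappa>}. (flip_sgn s k c a * flip_sgn s a c k * sr c) *\<^sub>R (b' q a c ** b' (r+1) c a - b' (q+1) a c ** b' r c a))
     = sr a *\<^sub>R (bprod a q (r+1) - bprod a (q+1) r)"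
    unfolding bprod_def sum_subtractf [symmetric] scaleR_sum_right
    by (rule sum.cong [OF refl], frule s_cases, insert k a s_cases[OF k] s_cases[OF a])
      (auto simp: b'_conv mult_sgn_def flip_sgn_def pty_def matrix_mult_uminus)
  have c: "mult_sgn s k a a k k = 1" "flip_sgn s k a a = 1" "flip_sgn s a a k = 1"
    by (simp_all add: mult_sgn_def flip_sgn_def minus_one_power_iff)
  from reflection_components[OF k a a k, of r q, simplified if_True refl simp_thms t1 t3, unfolded c bk e we] \<open>a \<noteq> k\<close>
  show ?thesis
    by (intro that[of e]) (simp add: algebra_simps)
qed

lemma b_0: "b 0 i j = (if i = j then real_of_int (\<epsilon> i) *\<^sub>R mat 1 else 0)"
  by (simp add: bint_def bcoef_def)

lemma b'_0: "b' 0 i j = (if i = j then real_of_int (\<epsilon> i) *\<^sub>R mat 1 else 0)"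
  by (auto simp: bsgn_def b_0 cB_def pty_def)

lemma weight_b':
  assumes i: "i \<in> {1..\<kappa>}" and k: "k \<in> {1..\<kappa>}" and l: "l \<in> {1..\<kappa>}"
  shows "b' 1 i i ** b' q k l - b' q k l ** b' 1 i i =
     (2 * sr i * real_of_int (\<epsilon> i) * ((if i = k then 1 else 0) - (if i = l then 1 else 0))) *\<^sub>R b' q k l"
proof -
  have n: "b' (-1) x y = 0" for x y by (simp add: bsgn_neg)
  have t1: "(\<Sum>c\<in>{1..\<kappa>}. (mult_sgn s i i k c l * flip_sgn s k i c * sr i) *\<^sub>R (b' 0 i c ** b' q c l))
     = (mult_sgn s i i k i l * flip_sgn s k i i * sr i * real_of_int (\<epsilon> i)) *\<^sub>R b' q i l"
  proof -
    have "(\<Sum>c\<in>{1..\<kappa>}. (mult_sgn s i i k c l * flip_sgn s k i c * sr i) *\<^sub>R (b' 0 i c ** b' q c l))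
      = (\<Sum>c\<in>{1..\<kappa>}. if c = i then (mult_sgn s i i k i l * flip_sgn s k i i * sr i * real_of_int (\<epsilon> i)) *\<^sub>R b' q i l else 0)"
      by (intro sum.cong refl) (auto simp: b'_0 scaleR_matrix_mult)
    then show ?thesis using i by simp
  qed
  have t3: "(\<Sum>c\<in>{1..\<kappa>}. (flip_sgn s i c i * flip_sgn s k c l * sr c) *\<^sub>R (b' q k c ** b' 0 c i))
     = (flip_sgn s i i i * flip_sgn s k i l * sr i * real_of_int (\<epsilon> i)) *\<^sub>R b' q k i"
  proof -
    have "(\<Sum>c\<in>{1..\<kappa>}. (flip_sgn s i c i * flip_sgn s k c l * sr c) *\<^sub>R (b' q k c ** b' 0 c i))
      = (\<Sum>c\<in>{1..\<kappa>}. if c = i then (flip_sgn s i i i * flip_sgn s k i l * sr i * real_of_int (\<epsilon> i)) *\<^sub>R b' q k i else 0)"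
      by (intro sum.cong refl) (auto simp: b'_0 scaleR_matrix_mult)
    then show ?thesis using i by simp
  qed
  have flip1: "flip_sgn s x y y = 1" and mult1: "mult_sgn s x x y y z = 1" for x y z
    by (simp_all add: flip_sgn_def mult_sgn_def minus_one_power_iff)
  have m1: "(-1 + 2 :: int) = 1" "(-1 + 1 :: int) = 0" by simp_all
  have eq: "b' 1 i i ** b' q k l - (mult_sgn s i i k i l * flip_sgn s i k i * sr k) *\<^sub>R (b' 0 k i ** b' q i l)
   - (if k = i then (mult_sgn s i i k i l * flip_sgn s k i i * sr i * real_of_int (\<epsilon> i)) *\<^sub>R b' q i l else 0)
   = b' q k l ** b' 1 i i
   - (if i = l then (flip_sgn s i i i * flip_sgn s k i l * sr i * real_of_int (\<epsilon> i)) *\<^sub>R b' q k i else 0)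
   - (flip_sgn s k i l * sr i) *\<^sub>R (b' q k i ** b' 0 i l)"
    \<comment> \<open>The choice \<open>r = -1\<close> selects the coefficient of
      \<open>u^1\<close>. Coefficients of index -1 are zero and those of index 0 are the scalars
      \<open>\<epsilon>\<close>, so only a commutator with \<open>b' 1 i i\<close> survives.\<close>
    using reflection_components[OF i i k l, of "-1" q]
    by (simp only: m1 n matrix_mult_zero diff_0_right add_0_right add_0_left scaleR_zero_right sum.neutral_const if_cancel t1 t3 mult1 scaleR_one)
  define e where "e = sr i * real_of_int (\<epsilon> i)"
  have x1: "(mult_sgn s i i k i l * flip_sgn s i k i * sr k) *\<^sub>R (b' 0 k i ** b' q i l) = (if k = i then e *\<^sub>R b' q k l else 0)"
    by (auto simp: b'_0 scaleR_matrix_mult flip1 mult1 e_def)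
  have x2: "(if k = i then (mult_sgn s i i k i l * flip_sgn s k i i * sr i * real_of_int (\<epsilon> i)) *\<^sub>R b' q i l else 0)
     = (if k = i then e *\<^sub>R b' q k l else 0)"
    by (auto simp: flip1 mult1 e_def)
  have x3: "(if i = l then (flip_sgn s i i i * flip_sgn s k i l * sr i * real_of_int (\<epsilon> i)) *\<^sub>R b' q k i else 0)
     = (if i = l then e *\<^sub>R b' q k l else 0)"
    by (auto simp: flip1 mult1 e_def)
  have x4: "(flip_sgn s k i l * sr i) *\<^sub>R (b' q k i ** b' 0 i l) = (if i = l then e *\<^sub>R b' q k l else 0)"
    by (auto simp: b'_0 scaleR_matrix_mult flip1 mult1 e_def)
  have fin: "P - x *\<^sub>R Z - x *\<^sub>R Z = Q - y *\<^sub>R Z - y *\<^sub>R Z \<Longrightarrow> P - Q = (2 * (x - y)) *\<^sub>R Z" for x y and P Q Z :: "'d op"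
    unfolding mult_2 scaleR_left_distrib scaleR_left_diff_distrib by (simp add: algebra_simps)
  have ifs: "(if P then e *\<^sub>R X else 0) = (if P then e else 0) *\<^sub>R X" for P and X :: "'d op" by simp
  show ?thesis
    unfolding fin[OF eq[unfolded x1 x2 x3 x4 ifs]] by (simp add: e_def)
qed

lemma weight_b:
  assumes i: "i \<in> {1..\<kappa>}" and k: "k \<in> {1..\<kappa>}" and l: "l \<in> {1..\<kappa>}"
  shows "b 1 i i ** b q k l - b q k l ** b 1 i i =
     (2 * sr i * real_of_int (\<epsilon> i) * ((if i = k then 1 else 0) - (if i = l then 1 else 0))) *\<^sub>R b q k l"
  using weight_b'[OF assms, of q] i k l
  by (auto simp: b'_conv matrix_mult_uminus algebra_simps split: if_splits)

section \<open>The filtration by degree and supercommutation up to lower terms\<close>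

text \<open>Two factors suffice, because every correction term in the reflection equation is
  quadratic. Index 0 is allowed, so scalars and single coefficients are included up to sign.\<close>

definition prods :: "int \<Rightarrow> ('d op) set" where
  "prods N = {b r i j ** b q k l | r q i j k l. r \<ge> 0 \<and> q \<ge> 0 \<and> r + q < N \<and>
      i \<in> {1..\<kappa>} \<and> j \<in> {1..\<kappa>} \<and> k \<in> {1..\<kappa>} \<and> l \<in> {1..\<kappa>}}"

lemma in_span_prods:
  assumes "r + q < N" "i \<in> {1..\<kappa>}" "j \<in> {1..\<kappa>}" "k \<in> {1..\<kappa>}" "l \<in> {1..\<kappa>}"
  shows "b' r i j ** b' q k l \<in> span (prods N)"
proof (cases "r < 0 \<or> q < 0")
  case True
  then have "b' r i j ** b' q k l = 0" by (auto simp: bsgn_neg)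
  then show ?thesis by (simp add: span_zero)
next
  case False
  then have "b r i j ** b q k l \<in> prods N"
    unfolding prods_def mem_Collect_eq using assms False
    by (intro exI[of _ r] exI[of _ q] exI[of _ i] exI[of _ j] exI[of _ k] exI[of _ l]) auto
  then show ?thesis by (simp add: bsgn_def scaleR_matrix_mult span_base span_scale)
qed

text \<open>Giving \<open>b\<^sup>(\<^sup>r\<^sup>)\<close> degree \<open>r\<close>, the associated graded algebra is supercommutative.\<close>
lemma supercomm_b':
  assumes i: "i \<in> {1..\<kappa>}" and j: "j \<in> {1..\<kappa>}" and k: "k \<in> {1..\<kappa>}" and l: "l \<in> {1..\<kappa>}"
  shows "mult_sgn s i j k k l *\<^sub>R (b' r i j ** b' q k l) - b' q k l ** b' r i j \<in> span (prods (r + q))"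
proof -
  define C where "C r q = mult_sgn s i j k k l *\<^sub>R (b' r i j ** b' q k l) - b' q k l ** b' r i j" for r q
  have rearr: "w *\<^sub>R (p - p') - X - Y + Z = (v - v') - U - G + H
     \<Longrightarrow> (w *\<^sub>R p - v) - (w *\<^sub>R p' - v') = X + Y - Z - U - G + H" for w and p p' X Y Z v v' U G H :: "'d op"
    by (simp add: scaleR_diff_right algebra_simps)
  have step: "C (r+2) q - C r (q+2) \<in> span (prods (r + 2 + q))" for r q
  proof -
    have "C (r+2) q - C r (q+2) =
      (mult_sgn s i j k i l * flip_sgn s i k j * sr k) *\<^sub>R (b' (r+1) k j ** b' q i l + b' r k j ** b' (q+1) i l)
   + (if k = j then \<Sum>c\<in>{1..\<kappa>}. (mult_sgn s i j k c l * flip_sgn s k j c * sr j) *\<^sub>R (b' (r+1) i c ** b' q c l - b' r i c ** b' (q+1) c l) else 0)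
   - (if i = j then \<Sum>c\<in>{1..\<kappa>}. (mult_sgn s i j k c l * flip_sgn s k j c * sr j * flip_sgn s i k c * sr k) *\<^sub>R (b' r k c ** b' q c l) else 0)
   - (if i = l then \<Sum>c\<in>{1..\<kappa>}. (flip_sgn s i c j * flip_sgn s k c l * sr c) *\<^sub>R (b' q k c ** b' (r+1) c j - b' (q+1) k c ** b' r c j) else 0)
   - (flip_sgn s k j l * sr j) *\<^sub>R (b' (q+1) k j ** b' r i l + b' q k j ** b' (r+1) i l)
   + (if i = j then \<Sum>c\<in>{1..\<kappa>}. (flip_sgn s k j l * sr j * flip_sgn s i c l * flip_sgn s k c j * sr c) *\<^sub>R (b' q k c ** b' r c l) else 0)"
      unfolding C_def by (rule rearr [OF reflection_components [OF assms]])
    also have "\<dots> \<in> span (prods (r + 2 + q))"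
      using assms by (intro span_diff span_add span_scale)
        (auto simp: span_zero intro!: span_sum span_diff span_add span_scale in_span_prods)
    finally show ?thesis .
  qed
  have neg: "C r q = 0" if "r < 0" for r q using that by (simp add: C_def bsgn_neg)
  \<comment> \<open>\<open>step\<close> trades two units of \<open>r\<close> for two units of
    \<open>q\<close> modulo lower total degree. The descent ends at negative \<open>r\<close>, where
    \<open>C\<close> vanishes.\<close>
  have "C (int n) q \<in> span (prods (int n + q))" for n q
  proof (induction n arbitrary: q rule: less_induct)
    case (less n)
    have "C (int n - 2) (q + 2) \<in> span (prods (int n + q))"
    proof (cases "n < 2")
      case True then show ?thesis by (simp add: neg span_zero)
    next
      case False
      then show ?thesis using less[of "n - 2" "q + 2"] by (simp add: of_nat_diff algebra_simps)
    qed
    moreover have "C (int n) q - C (int n - 2) (q + 2) \<in> span (prods (int n + q))"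
      using step[of "int n - 2" q] by simp
    ultimately show ?case by (metis diff_add_cancel span_add)
  qed
  then have "C r q \<in> span (prods (r + q))"
    by (cases "r < 0") (simp_all add: neg span_zero, metis int_nat_eq linorder_not_less)
  then show ?thesis by (simp add: C_def)
qed

lemma supercomm_b:
  assumes i: "i \<in> {1..\<kappa>}" and j: "j \<in> {1..\<kappa>}" and k: "k \<in> {1..\<kappa>}" and l: "l \<in> {1..\<kappa>}"
  obtains c Z where "b r i j ** b q k l = c *\<^sub>R (b q k l ** b r i j) + Z" "Z \<in> span (prods (r + q))"
proof -
  define t where "t = cB s i j * cB s k l"
  define w where "w = mult_sgn s i j k k l"
  have t: "t * t = 1" and w: "w * w = 1" by (auto simp: t_def w_def mult_sgn_def cB_def minus_one_power_iff)
  define Z where "Z = w *\<^sub>R (b' r i j ** b' q k l) - b' q k l ** b' r i j"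
  have Zs: "Z \<in> span (prods (r + q))" unfolding Z_def using supercomm_b'[OF assms] by (simp add: w_def)
  have "Z = (t * w) *\<^sub>R (b r i j ** b q k l) - t *\<^sub>R (b q k l ** b r i j)"
    by (simp add: Z_def bsgn_def scaleR_matrix_mult t_def mult.commute mult.left_commute)
  then have "(t * w) *\<^sub>R Z = (t * t * (w * w)) *\<^sub>R (b r i j ** b q k l) - (t * t * w) *\<^sub>R (b q k l ** b r i j)"
    by (simp add: scaleR_diff_right mult_ac)
  then have "b r i j ** b q k l = w *\<^sub>R (b q k l ** b r i j) + (t * w) *\<^sub>R Z" by (simp add: t w)
  then show ?thesis using Zs by (intro that[of w "(t * w) *\<^sub>R Z"]) (auto simp: span_scale)
qed

text \<open>As \<open>s_k^2 = 1\<close>, \<open>refl_kkkk\<close> factors as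
  \<open>(u - v - s_k) F(u,v) = 0\<close>, where \<open>F\<close> is the difference of the two sides
  of the claim. \<open>series_zero\<close> cancels the factor.\<close>

lemma bcomm_bprod_alt:
  assumes k: "k \<in> {1..\<kappa>}"
  shows "bcomm k (r+1) q + bcomm k r (q+1) = sr k *\<^sub>R bprod_alt k r q"
proof -
  define F where "F r q = bcomm k (r+1) q + bcomm k r (q+1) - sr k *\<^sub>R bprod_alt k r q" for r q
  have ss: "sr k * sr k = 1" using s_cases[OF k] by auto
  have step: "F (r+1) q = F r (q+1) + sr k *\<^sub>R F r q" for r q
    using refl_kkkk[OF k, of r q] ss unfolding F_def
    by (simp add: algebra_simps)
  have "F r q = 0"
  proof (rule series_zero[of "-1"])
    show "F r q = 0" if "r < -1" for r q
      using that by (auto simp: F_def bcomm_def bprod_alt_def bprod_def b_neg intro!: sum.neutral)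
    show "F r q = 0" if "\<And>r' q. r' < r \<Longrightarrow> F r' q = 0" for r q
      using step[of "r - 1" q] that[of "r - 1"] by simp
  qed
  then show ?thesis by (simp add: F_def)
qed

section \<open>Commuting diagonal series on singular vectors\<close>

definition killed :: "complex^'d \<Rightarrow> bool" where
  "killed x \<longleftrightarrow> (\<forall>i j r. 1 \<le> i \<and> i < j \<and> j \<le> \<kappa> \<longrightarrow> b r i j *v x = 0)"

text \<open>The terms with intermediate index \<open>a < k\<close> drop out because
  \<open>b_ak\<close> kills \<open>x\<close>.\<close>

lemma bprod_killed:
  assumes x: "killed x" and k: "k \<in> {1..\<kappa>}"
  shows "bprod k r q *v x = b r k k *v (b q k k *v x) + (\<Sum>a\<in>{k<..\<kappa>}. b r k a *v (b q a k *v x))"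
proof -
  have *: "{1..\<kappa>} = {1..<k} \<union> insert k {k<..\<kappa>}" using k by auto
  have "(\<Sum>a\<in>{1..<k}. b r k a *v (b q a k *v x)) = 0"
    using x k by (intro sum.neutral) (auto simp: killed_def)
  then show ?thesis unfolding bprod_def sum_mv mult_mv * by (subst sum.union_disjoint) auto
qed

definition "outer_alt x k a r q = b r k a *v (b q a k *v x) - b q k a *v (b r a k *v x)"

lemma bprod_alt_killed:
  assumes x: "killed x" and k: "k \<in> {1..\<kappa>}"
  shows "bprod_alt k r q *v x = bcomm k r q *v x + (\<Sum>a\<in>{k<..\<kappa>}. outer_alt x k a r q)"
  unfolding bprod_alt_def bcomm_def mv_simps bprod_killed[OF x k] mult_mv outer_alt_def sum_subtractf by simp

text \<open>Antisymmetrise \<open>refl_kaak\<close> in \<open>(r, q)\<close>. The mixed diagonal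
  products \<open>Y\<close> are antisymmetric and cancel; what remains is
  \<open>(u - v) G(u,v) = 0\<close>, where \<open>G\<close> is the difference of the two
  sides.\<close>

lemma outer_alt_killed:
  assumes x: "killed x" and k: "k \<in> {1..\<kappa>}" and a: "a \<in> {k<..\<kappa>}"
  shows "outer_alt x k a (r+1) q + outer_alt x k a r (q+1) = sr a *\<^sub>R (bprod_alt k r q *v x + bprod_alt a r q *v x)"
proof -
  have aK: "a \<in> {1..\<kappa>}" "a \<noteq> k" and ka: "1 \<le> k" "k < a" "a \<le> \<kappa>" using a k by auto
  define X where "X r q = b r k a *v (b q a k *v x)" for r q
  define Y where "Y r q = (b r a a ** b q k k - b q a a ** b r k k) *v x" for r q
  have kx: "b r k a *v x = 0" for r using x ka by (auto simp: killed_def)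
  have X: "X (r+2) q - X r (q+2) = sr a *\<^sub>R (Y (r+1) q + Y r (q+1))
     + sr a *\<^sub>R ((bprod k (r+1) q - bprod k r (q+1) - bprod a q (r+1) + bprod a (q+1) r) *v x)" for r q
  proof -
    obtain c1 where c: "b (r+2) k a ** b q a k - b r k a ** b (q+2) a k
    = c1 *\<^sub>R (b q a k ** b (r+2) k a - b (q+2) a k ** b r k a)
     + sr a *\<^sub>R (b (r+1) a a ** b q k k + b r a a ** b (q+1) k k - (b (q+1) a a ** b r k k + b q a a ** b (r+1) k k))
     + sr a *\<^sub>R (bprod k (r+1) q - bprod k r (q+1) - bprod a q (r+1) + bprod a (q+1) r)"
      using refl_kaak[OF aK(1) k aK(2)] by blast
    have "(b (r+2) k a ** b q a k - b r k a ** b (q+2) a k) *v x = X (r+2) q - X r (q+2)"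
      by (simp add: X_def mv_simps mult_mv)
    then show ?thesis unfolding c Y_def by (simp add: mv_simps mult_mv kx algebra_simps)
  qed
  define G where "G r q = outer_alt x k a (r+1) q + outer_alt x k a r (q+1) - sr a *\<^sub>R (bprod_alt k r q *v x + bprod_alt a r q *v x)" for r q
  have AX: "outer_alt x k a r q = X r q - X q r" for r q by (simp add: outer_alt_def X_def)
  have Y: "Y r q = - Y q r" for r q by (simp add: Y_def mv_simps)
  have step: "G (r+1) q = G r (q+1)" for r q
  proof -
    have "(X (r+2) q - X r (q+2)) + (X (q+2) r - X q (r+2)) =
        sr a *\<^sub>R ((bprod k (r+1) q - bprod k r (q+1) - bprod a q (r+1) + bprod a (q+1) r) *v x)
      + sr a *\<^sub>R ((bprod k (q+1) r - bprod k q (r+1) - bprod a r (q+1) + bprod a (r+1) q) *v x)"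
      unfolding X Y[of "r+1" q] Y[of r "q+1"] by (simp add: scaleR_diff_right scaleR_add_right)
    then show ?thesis unfolding G_def AX bprod_alt_def mv_simps by (simp add: algebra_simps)
  qed
  have "G r q = 0"
  proof (rule series_zero[of "-1"])
    show "G r q = 0" if "r < -1" for r q
      using that by (auto simp: G_def outer_alt_def bprod_alt_def bprod_def b_neg intro!: sum.neutral)
    show "G r q = 0" if "\<And>r' q. r' < r \<Longrightarrow> G r' q = 0" for r q
      using step[of "r - 1" q] that[of "r - 1"] by simp
  qed
  then show ?thesis by (simp add: G_def)
qed

text \<open>On a singular vector, \<open>(u + v) D\<^sub>k = s\<^sub>k D\<^sub>k + (\<Sum>a>k. s\<^sub>a (D\<^sub>k + D\<^sub>a))\<close> where
  \<open>D\<^sub>k\<close> is \<^term>\<open>bprod_alt k\<close>; hence \<open>(u + v - c) D\<^sub>k = 0\<close> by downward induction on \<open>k\<close>.\<close>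
lemma bprod_alt_zero:
  assumes x: "killed x" and k: "k \<in> {1..\<kappa>}"
  shows "bprod_alt k r q *v x = 0"
  using k
proof (induction "\<kappa> - k" arbitrary: k r q rule: less_induct)
  case less
  have IH: "bprod_alt a r q *v x = 0" if "a \<in> {k<..\<kappa>}" for a r q
    using less(1)[of a] less(2) that by auto
  define c where "c = sr k + (\<Sum>a\<in>{k<..\<kappa>}. sr a)"
  define E where "E r q = bprod_alt k r q *v x" for r q
  have "E (r+1) q + E r (q+1) = c *\<^sub>R E r q" for r q
  proof -
    have "E (r+1) q + E r (q+1) = (bcomm k (r+1) q + bcomm k r (q+1)) *v x + (\<Sum>a\<in>{k<..\<kappa>}. outer_alt x k a (r+1) q + outer_alt x k a r (q+1))"
      unfolding E_def bprod_alt_killed[OF x less(2)] by (simp add: mv_simps sum.distrib)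
    also have "(\<Sum>a\<in>{k<..\<kappa>}. outer_alt x k a (r+1) q + outer_alt x k a r (q+1)) = (\<Sum>a\<in>{k<..\<kappa>}. sr a *\<^sub>R E r q)"
      by (intro sum.cong refl) (simp add: outer_alt_killed[OF x less(2)] IH E_def)
    also have "(bcomm k (r+1) q + bcomm k r (q+1)) *v x = sr k *\<^sub>R E r q"
      by (simp add: bcomm_bprod_alt[OF less(2)] mv_simps E_def)
    finally show ?thesis by (simp add: c_def scaleR_left_distrib scaleR_sum_left)
  qed
  then have step: "E (r+1) q = c *\<^sub>R E r q - E r (q+1)" for r q by (simp add: eq_diff_eq)
  have "E r q = 0"
  proof (rule series_zero[of 0])
    show "E r q = 0" if "r < 0" for r q
      using that by (auto simp: E_def bprod_alt_def bprod_def b_neg intro!: sum.neutral)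
    show "E r q = 0" if "\<And>r' q. r' < r \<Longrightarrow> E r' q = 0" for r q
      using step[of "r - 1" q] that[of "r - 1"] by simp
  qed
  then show ?case by (simp add: E_def)
qed

text \<open>For \<open>i < k\<close>, \<open>refl_iikk\<close> applied to \<open>x\<close> loses its
  right-hand side, since \<open>b_ik x = 0\<close> and \<open>bprod_alt k\<close> vanishes on
  \<open>x\<close>; so \<open>u^2 - v^2\<close> times the commutator is zero. For
  \<open>i = k\<close>, \<open>bcomm_bprod_alt\<close> gives the same with factor
  \<open>u + v\<close>.\<close>

lemma b_diag_commute:
  assumes x: "killed x" and i: "i \<in> {1..\<kappa>}" and k: "k \<in> {1..\<kappa>}"
  shows "b r i i *v (b q k k *v x) = b q k k *v (b r i i *v x)"
proof -
  have lt: "b r i i *v (b q k k *v x) = b q k k *v (b r i i *v x)"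
    if "i < k" "i \<in> {1..\<kappa>}" "k \<in> {1..\<kappa>}" for i k r q
  proof -
    note ik = that
    define W where "W r q = b r i i *v (b q k k *v x) - b q k k *v (b r i i *v x)" for r q
    have kx: "b r i k *v x = 0" for r using x that by (auto simp: killed_def)
    have step: "W (r+2) q = W r (q+2)" for r q
    proof -
      obtain c1 c2 where c: "(b (r+2) i i ** b q k k - b r i i ** b (q+2) k k) - (b q k k ** b (r+2) i i - b (q+2) k k ** b r i i)
        = c1 *\<^sub>R (b (r+1) k i ** b q i k + b r k i ** b (q+1) i k)
         - c2 *\<^sub>R (b (q+1) k i ** b r i k + b q k i ** b (r+1) i k) - bprod_alt k r q"
        using refl_iikk[OF ik(2,3)] ik(1) by blast
      have "W (r+2) q - W r (q+2) = ((b (r+2) i i ** b q k k - b r i i ** b (q+2) k k) - (b q k k ** b (r+2) i i - b (q+2) k k ** b r i i)) *v x"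
        by (simp add: W_def mv_simps mult_mv)
      also have "\<dots> = 0" unfolding c by (simp add: mv_simps mult_mv kx bprod_alt_zero[OF x ik(3)])
      finally show ?thesis by simp
    qed
    have "W r q = 0"
    proof (rule series_zero[of 0])
      show "W r q = 0" if "r < 0" for r q
        using that by (simp add: W_def b_neg)
      show "W r q = 0" if "\<And>r' q. r' < r \<Longrightarrow> W r' q = 0" for r q
        using step[of "r - 2" q] that[of "r - 2"] by simp
    qed
    then show ?thesis by (simp add: W_def)
  qed
  consider "i < k" | "k < i" | "i = k" by linarith
  then show ?thesis
  proof cases
    case 3
    define E where "E r q = bcomm k r q *v x" for r q
    have "E (r+1) q = - E r (q+1)" for r q
      using bcomm_bprod_alt[OF k, of r q] bprod_alt_zero[OF x k, of r q] unfolding E_def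
      by (metis add_eq_0_iff2 matrix_vector_mult_add_rdistrib scaleR_mv scaleR_zero_right)
    note step = this
    have "E r q = 0"
    proof (rule series_zero[of 0])
      show "E r q = 0" if "r < 0" for r q
        using that by (simp add: E_def bcomm_def b_neg)
      show "E r q = 0" if "\<And>r' q. r' < r \<Longrightarrow> E r' q = 0" for r q
        using step[of "r - 1" q] that[of "r - 1"] by simp
    qed
    then show ?thesis using 3 by (simp add: E_def bcomm_def mv_simps mult_mv)
  qed (use lt i k in \<open>auto intro: lt[symmetric]\<close>)
qed

section \<open>Weights and existence of a highest weight vector\<close>

lemma b_rho: "r \<ge> 1 \<Longrightarrow> b (int r) i j = \<rho> i j r"
  by (simp add: bint_def bcoef_def)

lemma b_cases:
  obtains "r < 0" "b r i j = 0" | "r = 0" | n where "n \<ge> 1" "b r i j = \<rho> i j n"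
proof -
  consider "r < 0" | "r = 0" | "r > 0" by linarith
  then show ?thesis
  proof cases
    case 3
    then show ?thesis using b_rho[of "nat r" i j] that(3)[of "nat r"] by simp
  qed (use that b_neg in auto)
qed

lemma b_mult_right:
  "b r i j *v (x + y) = b r i j *v x + b r i j *v y" "b r i j *v (c *s x) = c *s (b r i j *v x)"
  by (simp_all add: matrix_vector_right_distrib mv_smult)

lemma b_diag_eigen:
  assumes "\<And>r. r \<ge> 1 \<Longrightarrow> \<exists>c. \<rho> i i r *v x = c *s x"
  shows "\<exists>c. b r i i *v x = c *s x"
proof (cases rule: b_cases[of r i i])
  case 1
  then have "b r i i *v x = 0 *s x" by simp
  then show ?thesis by blast
next
  case 2
  then have "b r i i *v x = complex_of_real (real_of_int (\<epsilon> i)) *s x"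
    by (simp add: b_0 scaleR_mv scaleR_smult)
  then show ?thesis by blast
qed (use assms in auto)

text \<open>The signs \<open>s_i \<epsilon>_i\<close> undo those in \<open>weight_b\<close>, and the
  coefficients \<open>\<kappa> - i\<close> turn the two deltas there into the difference
  \<open>l - k\<close>.\<close>

definition "grading = (\<Sum>i\<in>{1..\<kappa>}. ((real \<kappa> - real i) * sr i * real_of_int (\<epsilon> i)) *\<^sub>R b 1 i i)"

lemma grading_commutator:
  assumes k: "k \<in> {1..\<kappa>}" and l: "l \<in> {1..\<kappa>}"
  shows "grading ** b q k l - b q k l ** grading = (2 * (real l - real k)) *\<^sub>R b q k l"
proof -
  let ?w = "\<lambda>i. (real \<kappa> - real i) * sr i * real_of_int (\<epsilon> i)"
  have sl: "(\<Sum>i\<in>I. f i) ** B = (\<Sum>i\<in>I. f i ** B)" and sr: "B ** (\<Sum>i\<in>I. f i) = (\<Sum>i\<in>I. B ** f i)"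
    for I :: "nat set" and f and B :: "'d op"
    by (induction I rule: infinite_finite_induct) (simp_all add: matrix_mult_add)
  have "grading ** b q k l - b q k l ** grading = (\<Sum>i\<in>{1..\<kappa>}. ?w i *\<^sub>R (b 1 i i ** b q k l - b q k l ** b 1 i i))"
    by (simp add: grading_def sl sr scaleR_matrix_mult sum_subtractf scaleR_diff_right)
  also have "\<dots> = (\<Sum>i\<in>{1..\<kappa>}. (if i = k then (2 * (real \<kappa> - real i)) *\<^sub>R b q k l else 0)
       - (if i = l then (2 * (real \<kappa> - real i)) *\<^sub>R b q k l else 0))"
  proof (rule sum.cong [OF HOL.refl])
    fix i assume i: "i \<in> {1..\<kappa>}"
    show "?w i *\<^sub>R (b 1 i i ** b q k l - b q k l ** b 1 i i) = (if i = k then (2 * (real \<kappa> - real i)) *\<^sub>R b q k l else 0)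
       - (if i = l then (2 * (real \<kappa> - real i)) *\<^sub>R b q k l else 0)"
      unfolding weight_b[OF i k l] using s_cases[OF i] eps_cases[OF i] by auto
  qed
  also have "\<dots> = (2 * (real l - real k)) *\<^sub>R b q k l"
    using k l by (simp add: sum_subtractf scaleR_left_diff_distrib[symmetric] right_diff_distrib)
  finally show ?thesis .
qed

lemma grading_shift:
  assumes x: "grading *v x = c *s x" and k: "k \<in> {1..\<kappa>}" and l: "l \<in> {1..\<kappa>}"
  shows "grading *v (b q k l *v x) = (c + 2 * (of_nat l - of_nat k)) *s (b q k l *v x)"
proof -
  have "grading *v (b q k l *v x) = (grading ** b q k l - b q k l ** grading) *v x + b q k l *v (grading *v x)"
    by (simp add: mv_simps mult_mv)
  then show ?thesis unfolding grading_commutator[OF k l] x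
    by (simp add: scaleR_mv mv_smult scaleR_smult vector_sadd_rdistrib add.commute)
qed

lemma killed_rho:
  "killed x \<longleftrightarrow> (\<forall>i j. 1 \<le> i \<and> i < j \<and> j \<le> \<kappa> \<longrightarrow> (\<forall>r\<ge>1. \<rho> i j r *v x = 0))"
proof
  assume "killed x"
  then show "\<forall>i j. 1 \<le> i \<and> i < j \<and> j \<le> \<kappa> \<longrightarrow> (\<forall>r\<ge>1. \<rho> i j r *v x = 0)"
    unfolding killed_def by (metis b_rho)
next
  assume *: "\<forall>i j. 1 \<le> i \<and> i < j \<and> j \<le> \<kappa> \<longrightarrow> (\<forall>r\<ge>1. \<rho> i j r *v x = 0)"
  show "killed x" unfolding killed_def
  proof (intro allI impI)
    fix i j r assume ij: "1 \<le> i \<and> i < j \<and> j \<le> \<kappa>"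
    show "b r i j *v x = 0"
      by (cases rule: b_cases[of r i j]) (use * ij in \<open>auto simp: b_0\<close>)
  qed
qed

text \<open>Boundedness of the spectrum is enough: take an eigenvalue whose real part is within 1 of
  the supremum. A nonzero \<open>b_ij x\<close> with \<open>i < j\<close> would have real part
  larger by at least 2.\<close>

lemma top_weight:
  obtains c where "\<exists>x. x \<noteq> 0 \<and> grading *v x = c *s x" "\<And>x. grading *v x = c *s x \<Longrightarrow> killed x"
proof -
  define S where "S = {c. \<exists>x. x \<noteq> 0 \<and> grading *v x = c *s x}"
  obtain C where C: "\<And>x c. x \<noteq> 0 \<Longrightarrow> grading *v x = c *s x \<Longrightarrow> norm c \<le> C"
    using eigenvalue_bound[of grading] by metis
  have "(\<chi> a. 1) \<noteq> (0 :: complex^'d)" by (simp add: vec_eq_iff)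
  then have "UNIV \<noteq> {0 :: complex^'d}" by blast
  then have "S \<noteq> {}" using eigenvector_exists[of UNIV grading] by (auto simp: S_def csubspace_def)
  moreover have bd: "bdd_above (Re ` S)"
    unfolding bdd_above_def S_def by (rule exI[of _ C]) (auto intro: order.trans[OF complex_Re_le_cmod C])
  ultimately obtain c where c: "c \<in> S" "Sup (Re ` S) - 1 < Re c"
    using less_cSup_iff[of "Re ` S" "Sup (Re ` S) - 1"] by auto
  have "killed x" if x: "grading *v x = c *s x" for x
    unfolding killed_def
  proof (intro allI impI, rule ccontr)
    fix i j r assume ij: "1 \<le> i \<and> i < j \<and> j \<le> \<kappa>" and ne: "b r i j *v x \<noteq> 0"
    have "c + 2 * (of_nat j - of_nat i) \<in> S"
      using grading_shift[OF x, of i j r] ij ne unfolding S_def by auto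
    then have "Re (c + 2 * (of_nat j - of_nat i)) \<in> Re ` S" by (rule imageI)
    then have "Re (c + 2 * (of_nat j - of_nat i)) \<le> Sup (Re ` S)" using bd by (rule cSup_upper)
    moreover have "real j - real i \<ge> 1" using ij by linarith
    ultimately show False using c(2) by simp
  qed
  then show ?thesis using c(1) that unfolding S_def by blast
qed

lemma hw_exists:
  assumes hom: "\<And>i j r. i \<in> {1..\<kappa>} \<Longrightarrow> j \<in> {1..\<kappa>} \<Longrightarrow> r \<ge> 1 \<Longrightarrow> homog_op pv (odd (pty s i + pty s j)) (\<rho> i j r)"
    and irr: "irreducible_rep \<kappa> pv \<rho>"
  shows "\<exists>\<eta>. hw_vector \<kappa> \<rho> \<eta>"
proof -
  have even: "homog_op pv False (b r i i)" if i: "i \<in> {1..\<kappa>}" for r i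
  proof (cases rule: b_cases[of r i i])
    case (3 n)
    then show ?thesis using hom[OF i i, of n] by simp
  qed (auto simp: homog_op_def b_0 mat_def split: if_splits)
  have "homog_op pv False (c *\<^sub>R M)" if "homog_op pv False M" for c M
    using that by (auto simp: homog_op_def)
  then have h_even: "homog_op pv False grading"
    unfolding grading_def by (intro homog_op_sum) (use even in blast)
  obtain c x where x: "x \<noteq> 0" "grading *v x = c *s x" and kill: "\<And>x. grading *v x = c *s x \<Longrightarrow> killed x"
    using top_weight by metis
  obtain t where t: "parity_part pv t x \<noteq> 0"
    using x(1) parity_part_sum[of pv x] by fastforce
  \<comment> \<open>\<open>grading\<close> and all \<open>b_ii\<close> are even, so they preserve
    each parity part of the eigenspace. Working in one part makes \<open>\<eta>\<close> homogeneous
    and the submodule it generates graded.\<close>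
  define W where "W = {x. grading *v x = c *s x \<and> parity_part pv t x = x}"
  define F where "F = {b r i i | r i. i \<in> {1..\<kappa>}}"
  have "csubspace W"
    by (auto simp: csubspace_def W_def parity_part_linear matrix_vector_right_distrib vector_add_ldistrib
        mv_smult vector_smult_assoc mult.commute)
  moreover have "M *v x \<in> W" if MF: "M \<in> F" and xW: "x \<in> W" for M x
  proof -
    obtain r i where M: "M = b r i i" "i \<in> {1..\<kappa>}" using MF by (auto simp: F_def)
    have "grading *v (M *v x) = c *s (M *v x)"
      using grading_shift[of x c i i r] M xW by (simp add: W_def)
    moreover have "parity_part pv t (M *v x) = M *v x"
      using homog_op_parity_part[OF even[OF M(2)], of r t x] M(1) xW by (simp add: W_def)
    ultimately show ?thesis by (simp add: W_def)
  qed
  moreover have "W \<noteq> {0}"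
  proof -
    have "grading *v parity_part pv t x = c *s parity_part pv t x"
      using homog_op_parity_part[OF h_even, of t x] x(2) by (simp add: parity_part_linear)
    then have "parity_part pv t x \<in> W" by (simp add: W_def parity_part_idem)
    then show ?thesis using t by blast
  qed
  moreover have "M *v (N *v x) = N *v (M *v x)" if "M \<in> F" "N \<in> F" "x \<in> W" for M N x
    using that kill by (auto simp: F_def W_def intro: b_diag_commute)
  ultimately obtain \<eta> where \<eta>: "\<eta> \<in> W" "\<eta> \<noteq> 0" "\<And>M. M \<in> F \<Longrightarrow> \<exists>c. M *v \<eta> = c *s \<eta>"
    using common_eigenvector[of W F] by blast
  have "graded pv (generated \<kappa> \<rho> \<eta>)"
    using hom \<eta>(1) by (intro graded_generated[where t = t]) (auto simp: W_def)
  then have "generated \<kappa> \<rho> \<eta> = UNIV"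
    using irr generated_props[where \<kappa> = \<kappa> and \<rho> = \<rho> and \<eta> = \<eta>] \<eta>(2) unfolding irreducible_rep_def by blast
  moreover have "\<exists>c. \<rho> i i r *v \<eta> = c *s \<eta>" if "i \<in> {1..\<kappa>}" "r \<ge> 1" for i r
  proof -
    have "b (int r) i i \<in> F" using that(1) unfolding F_def by blast
    then show ?thesis using \<eta>(3) b_rho[OF that(2)] by metis
  qed
  moreover have "killed \<eta>" using \<eta>(1) kill by (simp add: W_def)
  ultimately have "hw_vector \<kappa> \<rho> \<eta>" using \<eta>(2) unfolding hw_vector_def killed_rho by blast
  then show ?thesis by blast
qed

section \<open>Uniqueness\<close>

text \<open>Combinations of monomials in lowering coefficients \<open>b_ij\<close>,
  \<open>j < i\<close>, applied to \<open>\<eta>\<close>, with \<open>d\<close> bounding the total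
  degree. The degree is recorded because the reordering argument inducts on it.\<close>

inductive low :: "complex^'d \<Rightarrow> int \<Rightarrow> complex^'d \<Rightarrow> bool" for \<eta> where
  base: "low \<eta> 0 \<eta>"
| add: "low \<eta> d x \<Longrightarrow> low \<eta> d y \<Longrightarrow> low \<eta> d (x + y)"
| smult: "low \<eta> d x \<Longrightarrow> low \<eta> d (c *s x)"
| mono: "low \<eta> d x \<Longrightarrow> d \<le> e \<Longrightarrow> low \<eta> e x"
| step: "low \<eta> d x \<Longrightarrow> j < i \<Longrightarrow> i \<in> {1..\<kappa>} \<Longrightarrow> j \<in> {1..\<kappa>} \<Longrightarrow> r \<ge> 1 \<Longrightarrow> low \<eta> (d + r) (b r i j *v x)"

lemma low_nonneg: "low \<eta> d x \<Longrightarrow> d \<ge> 0"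
  by (induction rule: low.induct) auto

lemma low_zero: "d \<ge> 0 \<Longrightarrow> low \<eta> d 0"
  using low.mono[OF low.smult[OF low.base[of \<eta>], of 0], of d] by simp

text \<open>A weak form of the PBW spanning argument. The outer induction is on a bound
  \<open>n\<close> for the total degree, the inner one on the derivation of \<open>low\<close>. An
  arbitrary coefficient is moved past the leading lowering one: the exchanged term falls under the
  inner induction, the remainder under the outer.\<close>

lemma low_closed:
  assumes kill: "killed \<eta>" and diag: "\<And>i r. i \<in> {1..\<kappa>} \<Longrightarrow> \<exists>c. b r i i *v \<eta> = c *s \<eta>"
  shows "low \<eta> d x \<Longrightarrow> r \<ge> 0 \<Longrightarrow> i \<in> {1..\<kappa>} \<Longrightarrow> j \<in> {1..\<kappa>} \<Longrightarrow> d + r \<le> int n \<Longrightarrow> low \<eta> (d + r) (b r i j *v x)"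
proof (induction n arbitrary: d x r i j rule: less_induct)
  case (less n)
  note IH = less.IH
  have "r = 0 \<or> r \<ge> 1" using less.prems(2) by auto
  then show ?case
  proof
    assume "r = 0"
    then show ?thesis using less.prems(1) low_zero low_nonneg
      by (auto simp: b_0 scaleR_mv scaleR_smult intro: low.smult)
  next
    assume r: "r \<ge> 1"
    show ?thesis using less.prems(1,5)
    proof (induction rule: low.induct)
      case base
      consider "i < j" | "i = j" | "j < i" by linarith
      then show ?case
      proof cases
        case 1
        then have "b r i j *v \<eta> = 0" using kill less.prems(3,4) by (auto simp: killed_def)
        then show ?thesis using r by (simp add: low_zero)
      next
        case 2
        then obtain c where "b r i j *v \<eta> = c *s \<eta>" using diag less.prems(3) by blast
        then show ?thesis using low.mono[OF low.smult[OF low.base[of \<eta>], of c], of r] r by simp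
      next
        case 3
        then show ?thesis using low.step[OF low.base, of j i r \<eta>] less.prems(3,4) r by simp
      qed
    next
      case (add d x y)
      then show ?case by (simp add: b_mult_right low.add)
    next
      case (smult d x c)
      then show ?case by (simp add: b_mult_right low.smult)
    next
      case (mono d x e)
      then show ?case using low.mono[of \<eta> "d + r" "b r i j *v x" "e + r"] by simp
    next
      case (step d y l k r')
      obtain c Z where Z: "b r i j ** b r' k l = c *\<^sub>R (b r' k l ** b r i j) + Z" "Z \<in> span (prods (r + r'))"
        using supercomm_b[OF less.prems(3,4) step(3,4)] by metis
      have "low \<eta> (d + r) (b r i j *v y)" using step by simp
      then have 1: "low \<eta> (d + r' + r) (b r' k l *v (b r i j *v y))"
        using low.step[of \<eta> "d + r" "b r i j *v y" l k r'] step by (simp add: algebra_simps)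
      have 2: "low \<eta> (d + r' + r) (Z *v y)" using Z(2)
      proof (induction rule: span_induct)
        show "subspace {Z. low \<eta> (d + r' + r) (Z *v y)}"
          using low_nonneg[OF step(1)] step(5) r
          by (auto simp: subspace_def mv_simps scaleR_smult intro: low.add low.smult low_zero)
      next
        fix Z assume "Z \<in> prods (r + r')"
        then obtain r1 r2 i1 j1 i2 j2 where Z: "Z = b r1 i1 j1 ** b r2 i2 j2" "r1 \<ge> 0" "r2 \<ge> 0" "r1 + r2 < r + r'"
          "i1 \<in> {1..\<kappa>}" "j1 \<in> {1..\<kappa>}" "i2 \<in> {1..\<kappa>}" "j2 \<in> {1..\<kappa>}"
          unfolding prods_def by blast
        \<comment> \<open>The strict inequality in \<open>prods\<close> lowers the total degree, so
          the outer hypothesis applies to both factors in turn.\<close>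
        have lt: "nat (d + r1 + r2) < n" using Z step(5,7) low_nonneg[OF step(1)] r by linarith
        have l2: "low \<eta> (d + r2) (b r2 i2 j2 *v y)"
          by (rule IH[OF lt step(1) Z(3,7,8)]) (use Z in linarith)
        have "low \<eta> (d + r2 + r1) (b r1 i1 j1 *v (b r2 i2 j2 *v y))"
          by (rule IH[OF lt l2 Z(2,5,6)]) linarith
        then show "low \<eta> (d + r' + r) (Z *v y)"
          unfolding Z(1) mult_mv by (rule low.mono) (use Z in linarith)
      qed
      have "b r i j *v (b r' k l *v y) = complex_of_real c *s (b r' k l *v (b r i j *v y)) + Z *v y"
        unfolding mult_mv[symmetric] Z(1) by (simp add: mv_simps mult_mv scaleR_smult)
      then show ?case using low.add[OF low.smult[OF 1] 2] by simp
    qed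
  qed
qed

lemma hw_low:
  assumes "hw_vector \<kappa> \<rho> \<eta>"
  shows "\<exists>d. low \<eta> d x"
proof -
  define L where "L = {x. \<exists>d. low \<eta> d x}"
  have kill: "killed \<eta>" using assms by (simp add: hw_vector_def killed_rho)
  have diag: "\<exists>c. b r i i *v \<eta> = c *s \<eta>" if "i \<in> {1..\<kappa>}" for i r
    using assms that by (intro b_diag_eigen) (auto simp: hw_vector_def)
  have "csubspace L"
  proof -
    have "x + y \<in> L" if "x \<in> L" "y \<in> L" for x y
    proof -
      from that obtain d e where "low \<eta> d x" "low \<eta> e y" by (auto simp: L_def)
      then have "low \<eta> (max d e) x" "low \<eta> (max d e) y" by (auto intro: low.mono)
      then show ?thesis unfolding L_def by (auto intro: low.add)
    qed
    then show ?thesis unfolding csubspace_def using low_zero[of 0 \<eta>] by (auto simp: L_def intro: low.smult)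
  qed
  moreover have "invariant \<kappa> \<rho> L"
    unfolding invariant_def
  proof (intro ballI allI impI)
    fix i j r x assume ij: "i \<in> {1..\<kappa>}" "j \<in> {1..\<kappa>}" "(1::nat) \<le> r" "x \<in> L"
    then obtain d where d: "low \<eta> d x" by (auto simp: L_def)
    have "low \<eta> (d + int r) (b (int r) i j *v x)"
      by (rule low_closed[OF kill diag d, where n = "nat (d + int r)"]) (use ij in auto)
    then show "\<rho> i j r *v x \<in> L" using ij b_rho[of r i j] by (auto simp: L_def)
  qed
  moreover have "\<eta> \<in> L" unfolding L_def using low.base by blast
  ultimately have "generated \<kappa> \<rho> \<eta> \<subseteq> L" unfolding generated_def by blast
  then show ?thesis using assms by (auto simp: hw_vector_def L_def)
qed

section \<open>Comparing eigenvalues of highest weight vectors\<close>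

lemma hw_grading_eigen:
  assumes "hw_vector \<kappa> \<rho> \<eta>"
  obtains c where "grading *v \<eta> = c *s \<eta>"
proof -
  have "\<forall>i\<in>{1..\<kappa>}. \<exists>c. b 1 i i *v \<eta> = c *s \<eta>"
    using assms by (intro ballI b_diag_eigen) (auto simp: hw_vector_def)
  then obtain f where f: "\<And>i. i \<in> {1..\<kappa>} \<Longrightarrow> b 1 i i *v \<eta> = f i *s \<eta>" by metis
  have "grading *v \<eta> = (\<Sum>i\<in>{1..\<kappa>}. (complex_of_real ((real \<kappa> - real i) * sr i * real_of_int (\<epsilon> i)) * f i) *s \<eta>)"
    unfolding grading_def sum_mv by (intro sum.cong) (auto simp: scaleR_mv f scaleR_smult vector_smult_assoc)
  then show ?thesis unfolding vec.scale_sum_left[symmetric] by (rule that)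
qed

text \<open>Every vector is a multiple of \<open>\<eta>\<close> plus a combination of eigenvectors
  with eigenvalue \<open>c - n\<close>, \<open>n \<ge> 1\<close>. A polynomial in
  \<open>grading\<close> that kills the latter gives \<open>p(c') \<eta>' = a p(c) \<eta>\<close>;
  either \<open>c'\<close> is a root of \<open>p\<close>, or \<open>\<eta>'\<close> is a multiple of
  \<open>\<eta>\<close>.\<close>

lemma hw_compare:
  assumes hw: "hw_vector \<kappa> \<rho> \<eta>" and c: "grading *v \<eta> = c *s \<eta>" and c': "grading *v \<eta>' = c' *s \<eta>'"
  shows "(\<exists>a. \<eta>' = a *s \<eta>) \<or> (\<exists>n\<ge>1. c' = c - of_nat n)"
proof -
  define S where "S = {y. \<exists>n::nat. n \<ge> 1 \<and> grading *v y = (c - of_nat n) *s y}"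
  have low_S: "b r i j *v y \<in> S" if "y \<in> S \<or> y = \<eta>" "j < i" "i \<in> {1..\<kappa>}" "j \<in> {1..\<kappa>}" for r i j y
  proof -
    have "\<exists>n::nat. grading *v y = (c - of_nat n) *s y"
      using that(1) c unfolding S_def by (auto intro: exI[of _ 0])
    then obtain n :: nat where n: "grading *v y = (c - of_nat n) *s y" by blast
    have "grading *v (b r i j *v y) = (c - of_nat (n + 2 * (i - j))) *s (b r i j *v y)"
      using grading_shift[OF n that(3,4), of r] that(2) by (simp add: of_nat_diff algebra_simps)
    moreover have "n + 2 * (i - j) \<ge> 1" using that(2) by simp
    ultimately show ?thesis unfolding S_def by blast
  qed
  have low_span: "b r i j *v y \<in> vec.span S" if "y \<in> vec.span S" "j < i" "i \<in> {1..\<kappa>}" "j \<in> {1..\<kappa>}" for r i j y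
    using that(1)
  proof (induction rule: vec.span_induct)
    show "vec.subspace {x. b r i j *v x \<in> vec.span S}"
      by (auto simp: vec.subspace_def b_mult_right intro: vec.span_zero vec.span_add vec.span_scale)
  qed (use low_S that in \<open>auto intro: vec.span_base\<close>)
  have dec: "\<exists>a. x - a *s \<eta> \<in> vec.span S" if "low \<eta> d x" for d x
    using that
  proof induction
    case base
    then show ?case by (intro exI[of _ 1]) (simp add: vec.span_zero)
  next
    case (add d x y)
    then obtain a a' where "x - a *s \<eta> \<in> vec.span S" "y - a' *s \<eta> \<in> vec.span S" by blast
    then have "(x - a *s \<eta>) + (y - a' *s \<eta>) \<in> vec.span S" by (rule vec.span_add)
    then show ?case by (intro exI[of _ "a + a'"]) (simp add: algebra_simps vector_sadd_rdistrib)
  next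
    case (smult d x e)
    then obtain a where "x - a *s \<eta> \<in> vec.span S" by blast
    then have "e *s (x - a *s \<eta>) \<in> vec.span S" by (rule vec.span_scale)
    then show ?case by (intro exI[of _ "e * a"]) (simp add: vec.scale_right_diff_distrib vector_smult_assoc)
  next
    case (step d x j i r)
    then obtain a where "x - a *s \<eta> \<in> vec.span S" by blast
    then have "b r i j *v (x - a *s \<eta>) \<in> vec.span S" using low_span step by blast
    moreover have "a *s (b r i j *v \<eta>) \<in> vec.span S"
      using low_S[of \<eta> j i r] step by (auto intro: vec.span_base vec.span_scale)
    ultimately have "b r i j *v (x - a *s \<eta>) + a *s (b r i j *v \<eta>) \<in> vec.span S" by (rule vec.span_add)
    \<comment> \<open>A lowering coefficient sends both \<open>\<eta>\<close> and the span of
      \<open>S\<close> into the span of \<open>S\<close>, so no multiple of \<open>\<eta>\<close> is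
      left.\<close>
    then show ?case by (intro exI[of _ 0]) (simp add: matrix_vector_mult_diff_distrib mv_smult)
  qed
  obtain C where C: "\<And>x e. x \<noteq> 0 \<Longrightarrow> grading *v x = e *s x \<Longrightarrow> norm e \<le> C"
    using eigenvalue_bound[of grading] by metis
  \<comment> \<open>A nonzero vector of eigenvalue \<open>c - n\<close> forces
    \<open>n \<le> norm c + C\<close>, so finitely many linear factors kill all of
    \<open>S\<close>.\<close>
  define N where "N = nat \<lceil>norm c + C\<rceil>"
  define p where "p = (\<Prod>n\<in>{1..N}. [: - (c - of_nat n), 1 :])"
  have p: "poly p e = 0 \<longleftrightarrow> (\<exists>n\<in>{1..N}. e = c - of_nat n)" for e
    unfolding p_def poly_prod by (auto simp: algebra_simps add_eq_0_iff)
  have ker: "poly_apply grading p y = 0" if "y \<in> vec.span S" for y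
    using that
  proof (induction rule: vec.span_induct)
    show "vec.subspace {x. poly_apply grading p x = 0}"
      using poly_apply_right_smult[of grading p 0 0] by (auto simp: vec.subspace_def poly_apply_right_add poly_apply_right_smult)
  next
    fix y assume "y \<in> S"
    then obtain n :: nat where n: "n \<ge> 1" "grading *v y = (c - of_nat n) *s y" by (auto simp: S_def)
    have "y = 0 \<or> poly p (c - of_nat n) = 0"
    proof (cases "y = 0")
      case False
      have "real n = norm (c - (c - of_nat n))" by simp
      also have "\<dots> \<le> norm c + norm (c - of_nat n)" by (rule norm_triangle_ineq4)
      also have "\<dots> \<le> norm c + C" using C[OF False n(2)] by simp
      finally have "n \<le> N" unfolding N_def by linarith
      then show ?thesis using n p by auto
    qed simp
    then show "poly_apply grading p y = 0" unfolding poly_apply_eigen[OF n(2)] by auto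
  qed
  obtain d where "low \<eta> d \<eta>'" using hw_low[OF hw] by blast
  then obtain a where "\<eta>' - a *s \<eta> \<in> vec.span S" using dec by blast
  then have "poly_apply grading p (\<eta>' - a *s \<eta>) = 0" by (rule ker)
  then have "poly_apply grading p \<eta>' = a *s poly_apply grading p \<eta>"
    using poly_apply_right_add[of grading p "\<eta>' - a *s \<eta>" "a *s \<eta>"] by (simp add: poly_apply_right_smult)
  then have eq: "poly p c' *s \<eta>' = (a * poly p c) *s \<eta>"
    unfolding poly_apply_eigen[OF c] poly_apply_eigen[OF c'] by (simp add: vector_smult_assoc)
  show ?thesis
  proof (cases "poly p c' = 0")
    case True
    then show ?thesis using p by auto
  next
    case False
    then have "\<eta>' = (inverse (poly p c')) *s (poly p c' *s \<eta>')" by (simp add: vector_smult_assoc)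
    then show ?thesis unfolding eq by (auto simp: vector_smult_assoc)
  qed
qed

text \<open>If neither comparison gave proportionality, each of the two eigenvalues would be the
  other minus a positive integer, which is absurd.\<close>

lemma hw_unique:
  assumes "hw_vector \<kappa> \<rho> \<eta>" "hw_vector \<kappa> \<rho> \<eta>'"
  shows "\<exists>a. \<eta>' = a *s \<eta>"
proof -
  obtain c c' where c: "grading *v \<eta> = c *s \<eta>" "grading *v \<eta>' = c' *s \<eta>'" using assms hw_grading_eigen by metis
  have "\<not> ((\<exists>n\<ge>1. c' = c - of_nat n) \<and> (\<exists>n\<ge>1. c = c' - of_nat n))"
  proof
    assume "(\<exists>n\<ge>1. c' = c - of_nat n) \<and> (\<exists>n\<ge>1. c = c' - of_nat n)"
    then obtain n m :: nat where "n \<ge> 1" "c' = c - of_nat n" "c = c' - of_nat m" by blast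
    then have "of_nat (n + m) = (0 :: complex)" by (simp add: algebra_simps)
    then show False using \<open>n \<ge> 1\<close> by (simp only: of_nat_eq_0_iff)
  qed
  then consider a where "\<eta>' = a *s \<eta>" | a where "\<eta> = a *s \<eta>'"
    using hw_compare[OF assms(1) c] hw_compare[OF assms(2) c(2,1)] by blast
  then show ?thesis
  proof cases
    case 2
    then have "a \<noteq> 0" using assms(1) by (auto simp: hw_vector_def)
    then have "\<eta>' = inverse a *s \<eta>" using 2 by (simp add: vector_smult_assoc)
    then show ?thesis by blast
  qed blast
qed

end

theorem theorem4p8:
  fixes m n :: nat and s \<epsilon> :: "nat \<Rightarrow> int"
    and pv :: "'d::finite \<Rightarrow> bool" and \<rho> :: "nat \<Rightarrow> nat \<Rightarrow> nat \<Rightarrow> complex^'d^'d"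
  assumes "\<forall>i\<in>{1..m+n}. s i = 1 \<or> s i = -1"
    and "card {i\<in>{1..m+n}. s i = 1} = m"
    and "\<forall>i\<in>{1..m+n}. \<epsilon> i = 1 \<or> \<epsilon> i = -1"
    and "is_rep (m+n) s \<epsilon> pv \<rho>"
    and "irreducible_rep (m+n) pv \<rho>"
  shows "(\<exists>\<eta>. hw_vector (m+n) \<rho> \<eta>)
       \<and> (\<forall>\<eta> \<eta>'. hw_vector (m+n) \<rho> \<eta> \<and> hw_vector (m+n) \<rho> \<eta>' \<longrightarrow> (\<exists>c. \<eta>' = c *s \<eta>))"
proof -
  interpret refl_alg "m + n" s \<epsilon> \<rho>
    using assms(1,3,4) by unfold_locales (auto simp: is_rep_def)
  have "homog_op pv (odd (pty s i + pty s j)) (\<rho> i j r)"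
    if "i \<in> {1..m+n}" "j \<in> {1..m+n}" "r \<ge> 1" for i j r
    using assms(4) that unfolding is_rep_def homog_op_def by blast
  then show ?thesis using hw_exists[OF _ assms(5)] hw_unique by blast
qed

end
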